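(* For a positive integer $t$, let $d_t$ be the natural density of the set of positive integers $n$ such that $t$ is a sum of distinct divisors of $n$. Suppose that there are real constants $c_3>0$ and $c_4$ such that \[ d_t=\frac{(1+o(1))\,c_3}{(\log t)^{c_4}}\qquad(t\to\infty). \] Then $\delta<c_4\le 1$, where $\delta=1-\frac{1+\log\log 2}{\log 2}=0.086071\ldots$. Moreover, if $c_4=1$, then $c_3\ge K$, where $K=c\,e^{-\gamma}$, $c$ is the practical-number constant and $\gamma$ is Euler's constant.
   Context: $\log$ is the natural logarithm. The natural density of a set $A$ of positive integers is $\lim_{x\to\infty}\#(A\cap[1,x])/x$; the density $d_t$ exists for every $t$. A positive integer $m$ is practical if every integer in $[1,m]$ is a sum of distinct divisors of $m$. The practical-number constant is $c=1.33607\ldots$, the constant for which $\#\{m\le x: m\text{ practical}\}\sim c\,x/\log x$ as $x\to\infty$; thus $K=0.75015\ldots$. *)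

theory Defs
  imports "HOL-Analysis.Analysis" "HOL-Library.Landau_Symbols"
begin

definition sum_of_distinct_divisors :: "nat \<Rightarrow> nat \<Rightarrow> bool" where
  "sum_of_distinct_divisors t n \<longleftrightarrow> (\<exists>S \<subseteq> {d. d dvd n}. \<Sum>S = t)"

text \<open>The density is the (unique) limit; \<^const>\<open>Lim\<close> is unspecified if the limit does not exist.
  It is applied below only to the sets defining \<open>d\<^sub>t\<close>, for which the limit does exist:
  membership of \<open>n\<close> depends only on the divisors of \<open>n\<close> up to \<open>t\<close>, so these sets are periodic.\<close>

definition natural_density :: "nat set \<Rightarrow> real" where
  "natural_density A = Lim at_top (\<lambda>x::real. real (card {n \<in> A. 1 \<le> n \<and> real n \<le> x}) / x)"

definition divisor_sum_density :: "nat \<Rightarrow> real" where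
  "divisor_sum_density t = natural_density {n. n \<ge> 1 \<and> sum_of_distinct_divisors t n}"

definition practical :: "nat \<Rightarrow> bool" where
  "practical m \<longleftrightarrow> m \<ge> 1 \<and> (\<forall>k\<in>{1..m}. sum_of_distinct_divisors k m)"

text \<open>This determines \<open>c\<close> uniquely and forces \<open>c > 0\<close>: the counting function is eventually
  positive, and only an eventually vanishing function is \<open>\<sim>\<close>-equivalent to \<open>0\<close>.\<close>

definition is_practical_constant :: "real \<Rightarrow> bool" where
  "is_practical_constant c \<longleftrightarrow>
     (\<lambda>x::real. real (card {m. practical m \<and> real m \<le> x})) \<sim>[at_top] (\<lambda>x. c * x / ln x)"

definition erdos_delta :: real where
  "erdos_delta = 1 - (1 + ln (ln 2)) / ln 2"

end

theory Submission
  imports Defs "HOL-Computational_Algebra.Squarefree" "HOL-Real_Asymp.Real_Asymp"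
begin

text \<open>
  Lower bound for \<open>d\<^sub>t\<close>: every \<open>n = m r\<close> with \<open>m \<ge> t\<close> practical represents \<open>t\<close>. If moreover all primes
  dividing \<open>r\<close> exceed \<open>\<sigma>(m) + 1\<close>, then \<open>m\<close> is determined by \<open>n\<close>, so these sets of \<open>n\<close> are disjoint
  and \<open>d\<^sub>t \<ge> \<Sum> 1/m \<Prod> (1 - 1/p)\<close>, the sum over practical \<open>m \<ge> t\<close> and the product over \<open>p \<le> \<sigma>(m) + 1\<close>.
  By Mertens' third theorem and partial summation this is at least \<open>(1 - o(1)) c e\<^sup>-\<^sup>\<gamma> / log t\<close>.

  Upper bound on average: an \<open>n\<close> with \<open>\<tau>\<close> divisors up to \<open>T\<close> represents at most \<open>min(T, 2\<^sup>\<tau>)\<close> of the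
  \<open>t \<le> T\<close>, so up to a negligible error the mean of the \<open>d\<^sub>t\<close> with \<open>t \<le> T\<close> is the density of those \<open>n\<close>
  with \<open>\<tau> \<ge> log T / 2\<close>. The number \<open>\<omega>\<close> of primes \<open>p \<le> T\<close> dividing \<open>n\<close> is dominated by a
  Poisson variable of parameter \<open>log log T + O(1)\<close>. Tilting it by \<open>y = 1 / log 2\<close> bounds that density
  by \<open>(log T)\<^sup>-\<^sup>\<delta>\<close> times the largest Poisson probability, which tends to \<open>0\<close> and makes the inequality
  \<open>\<delta> < c\<^sub>4\<close> strict.
\<close>

section \<open>Densities of periodic sets\<close>

text \<open>Every set of \<open>n\<close> that occurs is periodic, so all densities are exact
  frequencies in a common period \<open>Q\<close>, and disjointness and sieve identities require no
  passage to the limit. The constant demands Mertens' product with its exact factor. Primes are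
  grouped by \<open>n < ln p <= n + 1\<close>; Mertens' first theorem makes the block sums of
  \<open>- ln (1 - 1 / p)\<close> comparable with \<open>1 / (n + 1)\<close>, so Euler's constant
  enters through harmonic numbers, and the bound \<open>1 + 1 / \<sigma>\<close> for zeta at
  \<open>1 + \<sigma>\<close> controls the sum of the differences. For the average,
  \<open>log T\<close> is about \<open>2 ^ (k + 1)\<close>: half of it is a power of 2, and for
  squarefree \<open>n\<close> that many divisors force at least \<open>k\<close> prime divisors.
  Tilting by \<open>y\<close> yields the power \<open>y - 1 - ln y / ln 2\<close> of
  \<open>log T\<close>, minimal at \<open>y = 1 / ln 2\<close> with value
  \<open>- erdos_delta\<close>. The obstacle is that repeated prime factors give more divisors than
  subsets of primes. Writing \<open>d = u * v\<^sup>2\<close> with \<open>u\<close> squarefree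
  charges the excess to square divisors, which are rare enough because \<open>y < 2\<close>.\<close>

definition freq :: "nat \<Rightarrow> (nat \<Rightarrow> bool) \<Rightarrow> real" where
  "freq Q P = real (card {n \<in> {1..Q}. P n}) / real Q"

lemma card_Collect_Suc:
  "card {n \<in> {1..Suc N}. P n} = card {n \<in> {1..N}. P n} + (if P (Suc N) then 1 else 0)"
proof -
  have "{n \<in> {1..Suc N}. P n} = {n \<in> {1..N}. P n} \<union> (if P (Suc N) then {Suc N} else {})"
    by (auto simp: le_Suc_eq)
  then show ?thesis
    by (subst \<open>{n \<in> {1..Suc N}. P n} = _\<close>, subst card_Un_disjoint) auto
qed

lemma card_periodic_add:
  fixes N q :: nat
  assumes "\<And>n. n \<ge> 1 \<Longrightarrow> P (n + q) \<longleftrightarrow> P n"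
  shows "card {n \<in> {1..N + q}. P n} = card {n \<in> {1..N}. P n} + card {n \<in> {1..q}. P n}"
proof (induction N)
  case (Suc N)
  then show ?case
    using assms[of "Suc N"] card_Collect_Suc[of "N + q" P] card_Collect_Suc[of N P]
    by (simp del: atLeastAtMost_iff)
qed auto

lemma card_periodic_mult:
  fixes k q :: nat
  assumes "\<And>n. n \<ge> 1 \<Longrightarrow> P (n + q) \<longleftrightarrow> P n"
  shows "card {n \<in> {1..k * q}. P n} = k * card {n \<in> {1..q}. P n}"
proof (induction k)
  case (Suc k)
  then show ?case
    using card_periodic_add[of P q "k * q"] assms by (simp add: add.commute del: atLeastAtMost_iff)
qed auto

lemma freq_periodic:
  assumes "\<And>n. n \<ge> 1 \<Longrightarrow> P (n + q) \<longleftrightarrow> P n" "q dvd Q" "Q > 0"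
  shows "freq Q P = freq q P"
proof -
  obtain k where k: "Q = k * q" using assms(2) by (metis dvd_def mult.commute)
  with assms(3) have "k > 0" "q > 0" by auto
  then show ?thesis
    using card_periodic_mult[of P q k] assms(1) by (simp add: freq_def k del: atLeastAtMost_iff)
qed

text \<open>The discrepancy is itself periodic in \<open>N\<close>, because each full period adds
  exactly \<open>q * freq q P\<close>; hence its values for \<open>N < q\<close> bound it
  everywhere.\<close>

lemma card_periodic_diff_bounded:
  assumes per: "\<And>n. n \<ge> 1 \<Longrightarrow> P (n + q) \<longleftrightarrow> P n" and q: "q > 0"
  shows "\<bar>real (card {n \<in> {1..N}. P n}) - real N * freq q P\<bar> \<le> real q"
proof -
  define e where "e = (\<lambda>N. real (card {n \<in> {1..N}. P n}) - real N * freq q P)"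
  have step: "e (N + q) = e N" for N
    using card_periodic_add[of P q N] per q
    by (simp add: e_def freq_def field_simps del: atLeastAtMost_iff)
  have "e (r + k * q) = e r" for r k
  proof (induction k)
    case (Suc k)
    then show ?case using step[of "r + k * q"] by (simp add: ac_simps)
  qed auto
  from this[of "N mod q" "N div q"] have "e N = e (N mod q)" by simp
  moreover have "\<bar>e r\<bar> \<le> real q" if "r < q" for r
  proof -
    have "card {n \<in> {1..r}. P n} \<le> card {1..r}" "card {n \<in> {1..q}. P n} \<le> card {1..q}"
      by (rule card_mono; force)+
    then have "real (card {n \<in> {1..r}. P n}) \<le> r" "0 \<le> freq q P" "freq q P \<le> 1"
      using that q by (auto simp: freq_def simp del: atLeastAtMost_iff)
    moreover from this have "0 \<le> real r * freq q P" "real r * freq q P \<le> real r * 1"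
      by (auto intro!: mult_left_mono simp del: mult_1_right)
    ultimately show ?thesis
      using that unfolding e_def by (smt (verit) of_nat_0_le_iff of_nat_less_iff)
  qed
  ultimately show ?thesis using q by (simp add: e_def del: atLeastAtMost_iff)
qed

lemma natural_density_periodic:
  assumes per: "\<And>n. n \<ge> 1 \<Longrightarrow> P (n + q) \<longleftrightarrow> P n" and q: "q > 0"
  shows "natural_density {n. n \<ge> 1 \<and> P n} = freq q P"
proof -
  define c where "c = (\<lambda>N. real (card {n \<in> {1..N}. P n}))"
  have eq: "real (card {n \<in> {n. n \<ge> 1 \<and> P n}. 1 \<le> n \<and> real n \<le> x}) = c (nat \<lfloor>x\<rfloor>)"
    if "x \<ge> 1" for x :: real
  proof -
    have "{n \<in> {n. n \<ge> 1 \<and> P n}. 1 \<le> n \<and> real n \<le> x} = {n \<in> {1..nat \<lfloor>x\<rfloor>}. P n}"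
      using that by (auto simp: le_nat_floor) (metis le_floor_iff of_int_of_nat_eq le_nat_iff floor_le_iff nat_0_le zero_le_floor order_trans zero_le_one)
    then show ?thesis by (simp add: c_def del: atLeastAtMost_iff)
  qed
  have bd: "\<bar>c N - real N * freq q P\<bar> \<le> q" for N
    unfolding c_def by (rule card_periodic_diff_bounded) (use assms in auto)
  have f: "0 \<le> freq q P" by (simp add: freq_def)
  have "((\<lambda>x::real. c (nat \<lfloor>x\<rfloor>) / x) \<longlongrightarrow> freq q P) at_top"
  proof (rule tendsto_sandwich)
    show "\<forall>\<^sub>F x::real in at_top. (real (nat \<lfloor>x\<rfloor>) * freq q P - q) / x \<le> c (nat \<lfloor>x\<rfloor>) / x"
      using eventually_gt_at_top[of 0]
    proof eventually_elim
      case (elim x)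
      then show ?case using bd[of "nat \<lfloor>x\<rfloor>"] by (intro divide_right_mono) auto
    qed
    show "\<forall>\<^sub>F x::real in at_top. c (nat \<lfloor>x\<rfloor>) / x \<le> (real (nat \<lfloor>x\<rfloor>) * freq q P + q) / x"
      using eventually_gt_at_top[of 0]
    proof eventually_elim
      case (elim x)
      then show ?case using bd[of "nat \<lfloor>x\<rfloor>"] by (intro divide_right_mono) auto
    qed
    have fl: "((\<lambda>x::real. real (nat \<lfloor>x\<rfloor>) / x) \<longlongrightarrow> 1) at_top" by real_asymp
    have q0: "((\<lambda>x::real. real q / x) \<longlongrightarrow> 0) at_top" by real_asymp
    have "((\<lambda>x::real. real (nat \<lfloor>x\<rfloor>) / x * freq q P - q / x) \<longlongrightarrow> 1 * freq q P - 0) at_top"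
      by (intro tendsto_intros fl q0)
    then show "((\<lambda>x::real. (real (nat \<lfloor>x\<rfloor>) * freq q P - q) / x) \<longlongrightarrow> freq q P) at_top"
      by (simp add: diff_divide_distrib)
    have "((\<lambda>x::real. real (nat \<lfloor>x\<rfloor>) / x * freq q P + q / x) \<longlongrightarrow> 1 * freq q P + 0) at_top"
      by (intro tendsto_intros fl q0)
    then show "((\<lambda>x::real. (real (nat \<lfloor>x\<rfloor>) * freq q P + q) / x) \<longlongrightarrow> freq q P) at_top"
      by (simp add: add_divide_distrib)
  qed
  then have "((\<lambda>x::real. real (card {n \<in> {n. n \<ge> 1 \<and> P n}. 1 \<le> n \<and> real n \<le> x}) / x)
      \<longlongrightarrow> freq q P) at_top"
  proof (rule Lim_transform_eventually)
    show "\<forall>\<^sub>F x::real in at_top. c (nat \<lfloor>x\<rfloor>) / x =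
        real (card {n \<in> {n. n \<ge> 1 \<and> P n}. 1 \<le> n \<and> real n \<le> x}) / x"
      using eventually_ge_at_top[of "1::real"] by eventually_elim (simp only: eq)
  qed
  then show ?thesis unfolding natural_density_def by (intro tendsto_Lim) auto
qed

text \<open>No element of a set with sum \<open>t\<close> exceeds \<open>t\<close>, so a
  representation of \<open>t\<close> by divisors of one number uses only divisors that the other
  number shares.\<close>

lemma sum_of_distinct_divisors_cong:
  assumes "\<And>d. 1 \<le> d \<Longrightarrow> d \<le> t \<Longrightarrow> d dvd m \<longleftrightarrow> d dvd n" "m > 0" "n > 0"
  shows "sum_of_distinct_divisors t m \<longleftrightarrow> sum_of_distinct_divisors t n"
proof -
  have "sum_of_distinct_divisors t n"
    if "\<And>d. 1 \<le> d \<Longrightarrow> d \<le> t \<Longrightarrow> d dvd m \<longleftrightarrow> d dvd n" "m > 0" "n > 0"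
      and s: "sum_of_distinct_divisors t m" for m n
  proof -
    obtain S where S: "S \<subseteq> {d. d dvd m}" "\<Sum>S = t" using s by (auto simp: sum_of_distinct_divisors_def)
    have fin: "finite S" using S(1) \<open>m > 0\<close> finite_divisors_nat finite_subset by blast
    have "S \<subseteq> {d. d dvd n}"
    proof
      fix d assume d: "d \<in> S"
      then have "d dvd m" using S by auto
      moreover have "d \<le> t" using member_le_sum[of d S "\<lambda>x. x"] fin S d by auto
      moreover have "d \<ge> 1" using \<open>d dvd m\<close> \<open>m > 0\<close> by (simp add: dvd_pos_nat Suc_leI)
      ultimately show "d \<in> {d. d dvd n}" using that by auto
    qed
    then show ?thesis using S by (auto simp: sum_of_distinct_divisors_def)
  qed
  from this[of m n] this[of n m] show ?thesis using assms by blast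
qed

lemma sum_of_distinct_divisors_periodic:
  "n \<ge> 1 \<Longrightarrow> sum_of_distinct_divisors t (n + fact t) \<longleftrightarrow> sum_of_distinct_divisors t n"
  by (intro sum_of_distinct_divisors_cong) (auto simp: dvd_add_left_iff dvd_fact)

text \<open>\<open>Q\<close> may be any positive multiple of \<open>fact t\<close>, so that the
  densities for several \<open>t\<close>, together with sieve conditions, can be compared within one
  period.\<close>

lemma divisor_sum_density_eq_freq:
  assumes "fact t dvd Q" "Q > 0"
  shows "divisor_sum_density t = freq Q (sum_of_distinct_divisors t)"
  unfolding divisor_sum_density_def
  using natural_density_periodic[of "sum_of_distinct_divisors t" "fact t"]
    freq_periodic[of "sum_of_distinct_divisors t" "fact t" Q]
    sum_of_distinct_divisors_periodic assms by simp

lemma freq_mono: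
  assumes "\<And>n. n \<ge> 1 \<Longrightarrow> n \<le> Q \<Longrightarrow> P n \<Longrightarrow> R n"
  shows "freq Q P \<le> freq Q R"
  unfolding freq_def by (intro divide_right_mono of_nat_mono card_mono) (use assms in auto)

lemma freq_nonneg: "freq Q P \<ge> 0"
  by (simp add: freq_def)

lemma freq_True: "Q > 0 \<Longrightarrow> freq Q (\<lambda>_. True) = 1"
  by (simp add: freq_def del: atLeastAtMost_iff)

lemma freq_disj_le: "freq Q (\<lambda>n. P n \<or> R n) \<le> freq Q P + freq Q R"
proof -
  have "{n \<in> {1..Q}. P n \<or> R n} = {n \<in> {1..Q}. P n} \<union> {n \<in> {1..Q}. R n}" by auto
  then have "card {n \<in> {1..Q}. P n \<or> R n} \<le> card {n \<in> {1..Q}. P n} + card {n \<in> {1..Q}. R n}"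
    by (simp add: card_Un_le del: atLeastAtMost_iff)
  then show ?thesis unfolding freq_def
    by (subst add_divide_distrib [symmetric], intro divide_right_mono) (auto simp flip: of_nat_add)
qed

lemma freq_eq_sum: "freq Q P = (\<Sum>n=1..Q. of_bool (P n)) / real Q"
proof -
  have "{n \<in> {1..Q}. P n} = {1..Q} \<inter> Collect P" by auto
  then show ?thesis by (simp add: freq_def)
qed

lemma freq_bex_le:
  assumes "finite I"
  shows "freq Q (\<lambda>n. \<exists>i\<in>I. P i n) \<le> (\<Sum>i\<in>I. freq Q (P i))"
  using assms
proof (induction I)
  case (insert i I)
  have "freq Q (\<lambda>n. \<exists>j\<in>insert i I. P j n) \<le> freq Q (P i) + freq Q (\<lambda>n. \<exists>j\<in>I. P j n)"
    using freq_disj_le[of Q "P i" "\<lambda>n. \<exists>j\<in>I. P j n"] by simp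
  then show ?case using insert by simp
qed (simp add: freq_def)

lemma freq_bex_disjoint:
  assumes "finite I"
    and "\<And>n i j. n \<ge> 1 \<Longrightarrow> i \<in> I \<Longrightarrow> j \<in> I \<Longrightarrow> P i n \<Longrightarrow> P j n \<Longrightarrow> i = j"
  shows "freq Q (\<lambda>n. \<exists>i\<in>I. P i n) = (\<Sum>i\<in>I. freq Q (P i))"
proof -
  have "{n \<in> {1..Q}. \<exists>i\<in>I. P i n} = (\<Union>i\<in>I. {n \<in> {1..Q}. P i n})" by auto
  also have "card \<dots> = (\<Sum>i\<in>I. card {n \<in> {1..Q}. P i n})"
    by (rule card_UN_disjoint) (use assms in fastforce)+
  finally show ?thesis by (simp add: freq_def sum_divide_distrib del: atLeastAtMost_iff)
qed

section \<open>Multiples, and sieving by finitely many primes\<close>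

lemma freq_dvd_mult:
  assumes "m dvd Q" "Q > 0"
  shows "freq Q (\<lambda>n. m dvd n \<and> P (n div m)) = freq (Q div m) P / m"
proof -
  obtain k where k: "Q = m * k" using assms by auto
  then have m: "m > 0" using assms by auto
  have "{n \<in> {1..Q}. m dvd n \<and> P (n div m)} = (\<lambda>r. m * r) ` {r \<in> {1..k}. P r}"
    using m by (auto simp: k image_iff elim!: dvdE)
  also have "card \<dots> = card {r \<in> {1..k}. P r}"
    by (rule card_image) (use m in \<open>auto simp: inj_on_def\<close>)
  finally show ?thesis using m by (simp add: freq_def k del: atLeastAtMost_iff)
qed

lemma freq_dvd: "m dvd Q \<Longrightarrow> Q > 0 \<Longrightarrow> freq Q (\<lambda>n. m dvd n) = 1 / m"
  using freq_dvd_mult[of m Q "\<lambda>_. True"] freq_True[of "Q div m"]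
  by (auto simp: dvd_div_eq_0_iff elim!: dvdE)

lemma prod_primes_dvd_iff:
  fixes n :: nat
  assumes "finite D" "\<And>p. p \<in> D \<Longrightarrow> prime p"
  shows "\<Prod>D dvd n \<longleftrightarrow> (\<forall>p\<in>D. p dvd n)"
  using assms
proof (induction D)
  case (insert p D)
  have "coprime p (\<Prod>D)"
    by (rule prod_coprime_right) (use insert in \<open>auto intro!: primes_coprime\<close>)
  then show ?case using insert by (auto intro: divides_mult dest: dvd_mult_left dvd_mult_right)
qed auto

lemma freq_sieve:
  assumes "finite E" "finite D" "\<And>p. p \<in> D \<union> E \<Longrightarrow> prime p" "D \<inter> E = {}"
    and "\<Prod>(D \<union> E) dvd Q" "Q > 0"
  shows "freq Q (\<lambda>n. (\<forall>p\<in>D. p dvd n) \<and> (\<forall>p\<in>E. \<not> p dvd n)) =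
           (\<Prod>p\<in>D. 1 / real p) * (\<Prod>p\<in>E. 1 - 1 / real p)"
  using assms
proof (induction E arbitrary: D)
  case empty
  have "freq Q (\<lambda>n. \<forall>p\<in>D. p dvd n) = freq Q (\<lambda>n. \<Prod>D dvd n)"
    using prod_primes_dvd_iff[of D] empty by simp
  also have "\<dots> = 1 / real (\<Prod>D)" using freq_dvd empty by auto
  finally show ?case by (simp add: prod_dividef of_nat_prod)
next
  case (insert q E)
  let ?F = "\<lambda>D E n. (\<forall>p\<in>D. p dvd n) \<and> (\<forall>p\<in>E. \<not> p dvd n)"
  have un: "D \<union> insert q E = insert q D \<union> E" by auto
  have d1: "\<Prod>(insert q D \<union> E) dvd Q" using insert.prems un by simp
  have "\<Prod>(D \<union> E) dvd \<Prod>(insert q D \<union> E)"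
    using insert.prems(1) insert.hyps by (intro prod_dvd_prod_subset) auto
  then have d2: "\<Prod>(D \<union> E) dvd Q" using d1 dvd_trans by blast
  \<comment> \<open>A Boolean index turns the two-way split into an instance of
    \<open>freq_bex_disjoint\<close>.\<close>
  have s: "freq Q (\<lambda>n. \<exists>i\<in>{True,False}. (if i then ?F (insert q D) E n else ?F D (insert q E) n)) =
    (\<Sum>i\<in>{True,False}. freq Q (\<lambda>n. if i then ?F (insert q D) E n else ?F D (insert q E) n))"
    by (rule freq_bex_disjoint) (auto split: if_splits)
  have "freq Q (?F D E) = freq Q (?F (insert q D) E) + freq Q (?F D (insert q E))"
  proof -
    have "(\<lambda>n. \<exists>i\<in>{True,False}. (if i then ?F (insert q D) E n else ?F D (insert q E) n)) = ?F D E"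
      by auto
    then show ?thesis using s by simp
  qed
  moreover have "freq Q (?F D E) = (\<Prod>p\<in>D. 1 / real p) * (\<Prod>p\<in>E. 1 - 1 / real p)"
    by (rule insert.IH) (use insert.prems d2 in auto)
  moreover have "freq Q (?F (insert q D) E) = (\<Prod>p\<in>insert q D. 1 / real p) * (\<Prod>p\<in>E. 1 - 1 / real p)"
    by (rule insert.IH) (use insert.prems insert.hyps d1 in auto)
  moreover have "(\<Prod>p\<in>insert q D. 1 / real p) = 1 / real q * (\<Prod>p\<in>D. 1 / real p)"
    using insert.prems by (subst prod.insert) auto
  ultimately show ?case using insert.hyps by (simp add: algebra_simps)
qed

section \<open>Chebyshev's and Mertens' first theorem\<close>

definition primes_upto :: "real \<Rightarrow> nat set" where
  "primes_upto x = {p. prime p \<and> real p \<le> x}"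

lemma finite_primes_upto [simp, intro]: "finite (primes_upto x)"
  by (rule finite_subset[of _ "{..nat \<lfloor>x\<rfloor>}"]) (auto simp: primes_upto_def le_nat_floor)

lemma primes_upto_of_nat: "primes_upto (real n) = {p. prime p \<and> p \<le> n}"
  by (simp add: primes_upto_def)

lemma primes_upto_mono: "x \<le> y \<Longrightarrow> primes_upto x \<subseteq> primes_upto y"
  by (auto simp: primes_upto_def)

lemma prime_upto_ge_2: "p \<in> primes_upto x \<Longrightarrow> real p \<ge> 2"
  by (auto simp: primes_upto_def dest: prime_ge_2_nat)

section \<open>Chebyshev's upper bound\<close>

lemma binomial_odd_le: "(2 * m + 1) choose m \<le> 4 ^ m"
proof -
  have "2 * ((2 * m + 1) choose m) = (\<Sum>k\<in>{m, Suc m}. (2 * m + 1) choose k)"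
    using binomial_symmetric[of m "2 * m + 1"] by simp
  also have "\<dots> \<le> (\<Sum>k\<le>2 * m + 1. (2 * m + 1) choose k)"
    by (rule sum_mono2) auto
  also have "\<dots> = 2 * 4 ^ m"
    using choose_row_sum[of "2 * m + 1"] by (simp add: power_mult)
  finally show ?thesis by simp
qed

text \<open>Erdos' argument. The primes in \<open>(m + 1, 2 * m + 1]\<close> divide
  \<open>fact (2 * m + 1)\<close> but neither \<open>fact m\<close> nor \<open>fact (Suc m)\<close>,
  so their product divides a middle binomial coefficient, one of two equal terms in a row of sum
  \<open>2 * 4 ^ m\<close>.\<close>

lemma primorial_le: "\<Prod>{p. prime p \<and> p \<le> n} \<le> (4::nat) ^ n"
proof (induction n rule: less_induct)
  case (less n)
  have "n \<le> 1 \<or> n = 2 \<or> (n > 2 \<and> even n) \<or> (\<exists>m\<ge>1. n = 2 * m + 1)" by presburger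
  then consider "n \<le> 1" | "n = 2" | "n > 2" "even n" | m where "n = 2 * m + 1" "m \<ge> 1"
    by blast
  then show ?case
  proof cases
    case 1
    then have e: "{p. prime p \<and> p \<le> n} = {}" by (auto dest: prime_ge_2_nat)
    show ?thesis unfolding e by simp
  next
    case 2
    then have e: "{p. prime p \<and> p \<le> n} = {2}" by (auto dest: prime_ge_2_nat)
    show ?thesis unfolding e using 2 by simp
  next
    case 3
    then have "\<not> prime n" using prime_odd_nat by blast
    have e: "{p. prime p \<and> p \<le> n} = {p. prime p \<and> p \<le> n - 1}" (is "?L = ?R")
    proof (intro equalityI subsetI)
      fix p assume "p \<in> ?L"
      then show "p \<in> ?R" using \<open>\<not> prime n\<close> by (cases "p = n") auto
    qed auto
    have "\<Prod>{p. prime p \<and> p \<le> n} \<le> (4::nat) ^ (n - 1)"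
      unfolding e by (rule less) (use 3 in simp)
    also have "\<dots> \<le> 4 ^ n" by (intro power_increasing) auto
    finally show ?thesis .
  next
    case (4 m)
    let ?B = "{p. prime p \<and> m + 1 < p \<and> p \<le> n}"
    have e: "{p. prime p \<and> p \<le> n} = {p. prime p \<and> p \<le> m + 1} \<union> ?B" using 4 by auto
    have split: "\<Prod>{p. prime p \<and> p \<le> n} = \<Prod>{p. prime p \<and> p \<le> m + 1} * \<Prod>?B"
      unfolding e by (rule prod.union_disjoint) auto
    have "\<Prod>?B dvd (2 * m + 1) choose m"
    proof -
      have "\<forall>p\<in>?B. p dvd (2 * m + 1) choose m"
      proof
        fix p assume p: "p \<in> ?B"
        have "fact m * fact (Suc m) * ((2 * m + 1) choose m) = (fact (2 * m + 1) :: nat)"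
          using binomial_fact_lemma[of m "2 * m + 1"] by (simp add: Suc_diff_le del: fact_Suc)
        moreover have "p dvd fact (2 * m + 1)"
          using p 4 prime_dvd_fact_iff[of p "2 * m + 1"] by blast
        ultimately have "p dvd fact m * fact (Suc m) * ((2 * m + 1) choose m)" by argo
        moreover have "prime p" "\<not> p \<le> m" "\<not> p \<le> Suc m" using p by auto
        ultimately show "p dvd (2 * m + 1) choose m"
          by (metis prime_dvd_fact_iff prime_dvd_mult_iff)
      qed
      then show ?thesis by (subst prod_primes_dvd_iff) auto
    qed
    then have "\<Prod>?B \<le> (2 * m + 1) choose m" by (rule dvd_imp_le) simp
    then have "\<Prod>?B \<le> 4 ^ m" using binomial_odd_le[of m] by (rule order.trans)
    moreover have "\<Prod>{p. prime p \<and> p \<le> m + 1} \<le> (4::nat) ^ (m + 1)" using less[of "m + 1"] 4 by simp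
    ultimately have "\<Prod>{p. prime p \<and> p \<le> n} \<le> 4 ^ (m + 1) * 4 ^ m"
      unfolding split by (intro mult_mono) simp_all
    also have "\<dots> = 4 ^ n" using 4 by (simp flip: power_add)
    finally show ?thesis .
  qed
qed

lemma sum_ln_primes_le: "(\<Sum>p\<in>primes_upto (real n). ln (real p)) \<le> real n * ln 4"
proof -
  have "(\<Sum>p\<in>primes_upto (real n). ln (real p)) = ln (\<Prod>p\<in>primes_upto (real n). real p)"
    by (rule ln_prod [symmetric]) (auto dest: prime_upto_ge_2)
  also have "(\<Prod>p\<in>primes_upto (real n). real p) = real (\<Prod>{p. prime p \<and> p \<le> n})"
    by (simp add: primes_upto_of_nat of_nat_prod)
  also have "ln \<dots> \<le> ln (real (4 ^ n))"
    using primorial_le[of n]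
    by (subst ln_le_cancel_iff)
       (auto intro!: prod_pos simp: prime_gt_0_nat simp del: of_nat_prod of_nat_power)
  finally show ?thesis by (simp add: ln_realpow)
qed

section \<open>The logarithm of a factorial and Mertens' first theorem\<close>

lemma ln_fact_ge: "real n * ln (real n) - real n \<le> ln (fact n)"
proof (induction n)
  case (Suc n)
  show ?case
  proof (cases "n = 0")
    case False
    have "ln (real (Suc n)) - ln (real n) = ln (1 + 1 / real n)"
      using False ln_div[of "real (Suc n)" "real n"] by (simp add: add_divide_distrib add.commute)
    also have "\<dots> \<le> 1 / real n" by (rule ln_add_one_self_le_self) auto
    finally have "real n * (ln (real (Suc n)) - ln (real n)) \<le> real n * (1 / real n)"
      by (rule mult_left_mono) auto
    then have "real n * ln (real (Suc n)) - real n * ln (real n) \<le> 1"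
      using False by (simp add: algebra_simps)
    moreover have "ln (fact (Suc n) :: real) = ln (real (Suc n)) + ln (fact n)"
      by (simp add: ln_mult)
    ultimately show ?thesis using Suc by (simp add: algebra_simps)
  qed auto
qed auto

lemma multiplicity_eq_card:
  fixes p m :: nat
  assumes "prime p" "m > 0" "m \<le> n"
  shows "multiplicity p m = card {i \<in> {1..n}. p ^ i dvd m}"
proof -
  have nu: "\<not> is_unit p" using assms(1) by auto
  have "{i \<in> {1..n}. p ^ i dvd m} = {1..multiplicity p m}"
  proof -
    have "i \<le> n" if "p ^ i dvd m" for i
    proof -
      have "i < p ^ i" using prime_gt_1_nat[OF assms(1)] power_gt_expt[of p i] by simp
      also have "p ^ i \<le> m" using that assms by (simp add: dvd_imp_le)
      finally show ?thesis using assms by simp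
    qed
    then show ?thesis using nu assms power_dvd_iff_le_multiplicity[of m p] by auto
  qed
  then show ?thesis by simp
qed

text \<open>Legendre's formula, by counting the pairs \<open>(m, i)\<close> with
  \<open>p ^ i dvd m\<close> in two ways; \<open>multiplicity_eq_card\<close> supplies the common
  range \<open>{1..n}\<close> for \<open>i\<close>.\<close>

lemma multiplicity_fact_eq:
  fixes p :: nat
  assumes "prime p"
  shows "multiplicity p (fact n) = (\<Sum>i=1..n. n div p ^ i)"
proof -
  have cnt: "card {m \<in> {1..n}. d dvd m} = n div d" if "d > 0" for d :: nat
  proof -
    have "{m \<in> {1..n}. d dvd m} = (\<lambda>k. d * k) ` {1..n div d}"
      using that by (auto simp: image_iff less_eq_div_iff_mult_less_eq mult.commute elim!: dvdE)
    also have "card \<dots> = n div d"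
      by (subst card_image) (use that in \<open>auto simp: inj_on_def\<close>)
    finally show ?thesis .
  qed
  have "multiplicity p (fact n :: nat) = (\<Sum>m=1..n. multiplicity p m)"
    using assms by (subst fact_prod, simp, subst prime_elem_multiplicity_prod_distrib) (auto)
  also have "\<dots> = (\<Sum>m=1..n. \<Sum>i=1..n. of_bool (p ^ i dvd m))"
    by (intro sum.cong) (auto simp: multiplicity_eq_card[OF assms] Int_def)
  also have "\<dots> = (\<Sum>i=1..n. \<Sum>m=1..n. of_bool (p ^ i dvd m))"
    by (rule sum.swap)
  also have "\<dots> = (\<Sum>i=1..n. card {m \<in> {1..n}. p ^ i dvd m})"
    by (intro sum.cong) (auto simp: Int_def)
  also have "\<dots> = (\<Sum>i=1..n. n div p ^ i)"
    using prime_gt_0_nat[OF assms] by (intro sum.cong cnt) auto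
  finally show ?thesis .
qed

lemma ln_fact_eq:
  "ln (fact n :: real) = (\<Sum>p\<in>primes_upto (real n). real (multiplicity p (fact n :: nat)) * ln (real p))"
proof -
  have "(fact n :: nat) = (\<Prod>p\<in>prime_factors (fact n). p ^ multiplicity p (fact n))"
    using prod_prime_factors[of "fact n :: nat"] by simp
  also have "prime_factors (fact n :: nat) = primes_upto (real n)"
    by (auto simp: prime_factors_dvd primes_upto_def prime_dvd_fact_iff)
  finally have "real (fact n) = real (\<Prod>p\<in>primes_upto (real n). p ^ multiplicity p (fact n))"
    by (rule arg_cong)
  then have "(fact n :: real) = (\<Prod>p\<in>primes_upto (real n). real p ^ multiplicity p (fact n :: nat))"
    by simp
  then have "ln (fact n :: real) = ln (\<Prod>p\<in>primes_upto (real n). real p ^ multiplicity p (fact n :: nat))"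
    by simp
  also have "\<dots> = (\<Sum>p\<in>primes_upto (real n). ln (real p ^ multiplicity p (fact n :: nat)))"
    by (rule ln_prod) (auto dest: prime_upto_ge_2)
  also have "\<dots> = (\<Sum>p\<in>primes_upto (real n). real (multiplicity p (fact n :: nat)) * ln (real p))"
    by (intro sum.cong) (auto simp: ln_realpow dest: prime_upto_ge_2)
  finally show ?thesis .
qed

lemma multiplicity_fact_le:
  fixes p :: nat
  assumes "prime p"
  shows "real (multiplicity p (fact n)) \<le> real n / (real p - 1)"
proof -
  have p: "real p > 1" using prime_gt_1_nat[OF assms] by simp
  have geo: "(\<Sum>i=1..m. 1 / real p ^ i) = (1 - 1 / real p ^ m) / (real p - 1)" for m
  proof (induction m)
    case (Suc m)
    have "(\<Sum>i=1..Suc m. 1 / real p ^ i) = (1 - 1 / real p ^ m) / (real p - 1) + 1 / real p ^ Suc m"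
      using Suc by simp
    also have "\<dots> = (1 - 1 / real p ^ Suc m) / (real p - 1)"
      using p by (simp add: divide_simps) (simp add: algebra_simps)
    finally show ?case .
  qed auto
  have "real (multiplicity p (fact n)) = (\<Sum>i=1..n. real (n div p ^ i))"
    using assms by (simp add: multiplicity_fact_eq)
  also have "\<dots> \<le> (\<Sum>i=1..n. real n * (1 / real p ^ i))"
    by (intro sum_mono) (use of_nat_div_le_of_nat[of n "p ^ _", where 'a = real] in simp)
  also have "\<dots> = real n * ((1 - 1 / real p ^ n) / (real p - 1))"
    by (simp only: geo flip: sum_distrib_left)
  also have "\<dots> \<le> real n * (1 / (real p - 1))"
    using p by (intro mult_left_mono divide_right_mono) auto
  finally show ?thesis by simp
qed

lemma multiplicity_fact_ge:
  fixes p :: nat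
  assumes "prime p"
  shows "real n / real p - 1 \<le> real (multiplicity p (fact n))"
proof (cases "n = 0")
  case False
  have "real n / real p - 1 \<le> real (n div p)"
    using floor_correct[of "real n / real p"] floor_divide_of_nat_eq[of n p, where 'a = real] by linarith
  also have "n div p ^ 1 \<le> (\<Sum>i=1..n. n div p ^ i)"
    by (rule member_le_sum) (use False in auto)
  then have "real (n div p) \<le> real (multiplicity p (fact n))"
    using assms by (simp add: multiplicity_fact_eq del: of_nat_sum)
  finally show ?thesis .
qed auto

text \<open>This series and the next bound the errors made by exchanging \<open>1 / p\<close> and
  \<open>1 / (p - 1)\<close>. Division by zero makes the terms \<open>k = 0\<close> and
  \<open>k = 1\<close> vanish, so both series in effect start at 2.\<close>

lemma summable_ln_div: "summable (\<lambda>k. ln (real k) / (real k * (real k - 1)))"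
proof (rule summable_comparison_test_bigo)
  show "(\<lambda>k. ln (real k) / (real k * (real k - 1))) \<in> O(\<lambda>k. real k powr (-3/2))"
    by real_asymp
  show "summable (\<lambda>k. norm (real k powr (-3/2)))"
    by (simp add: summable_real_powr_iff)
qed

lemma summable_inverse_pronic: "summable (\<lambda>k. 1 / (real k * (real k - 1)))"
proof (rule summable_comparison_test_bigo)
  show "(\<lambda>k. 1 / (real k * (real k - 1))) \<in> O(\<lambda>k. real k powr (-3/2))"
    by real_asymp
  show "summable (\<lambda>k. norm (real k powr (-3/2)))"
    by (simp add: summable_real_powr_iff)
qed

lemma ln_div_pronic_nonneg: "ln (real k) / (real k * (real k - 1)) \<ge> 0"
  by (cases "k = 0") auto

lemma sum_primes_ln_div_le:
  assumes "finite X"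
  shows "(\<Sum>p\<in>X. ln (real p) / (real p * (real p - 1))) \<le> (\<Sum>k. ln (real k) / (real k * (real k - 1)))"
  using assms by (intro sum_le_suminf summable_ln_div ln_div_pronic_nonneg)

lemma inverse_pronic_nonneg: "1 / (real k * (real k - 1)) \<ge> 0"
  by (cases "k = 0") auto

lemma sum_primes_inverse_pronic_le:
  assumes "finite X"
  shows "(\<Sum>p\<in>X. 1 / (real p * (real p - 1))) \<le> (\<Sum>k. 1 / (real k * (real k - 1)))"
  using assms
  by (intro sum_le_suminf summable_inverse_pronic)
     (use inverse_pronic_nonneg in auto)

text \<open>The denominator \<open>p - 1\<close> sums the geometric series over all powers of
  \<open>p\<close>, which is how Legendre's formula presents the contribution of \<open>p\<close> to
  \<open>ln (fact n)\<close>.\<close>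

definition mertens_sum :: "real \<Rightarrow> real" where
  "mertens_sum x = (\<Sum>p\<in>primes_upto x. ln (real p) / (real p - 1))"

lemma mertens_sum_ge:
  assumes "n \<ge> 1"
  shows "ln (real n) - 1 \<le> mertens_sum (real n)"
proof -
  have "real n * ln (real n) - real n \<le> ln (fact n)" by (rule ln_fact_ge)
  also have "\<dots> \<le> (\<Sum>p\<in>primes_upto (real n). real n / (real p - 1) * ln (real p))"
    unfolding ln_fact_eq
    by (intro sum_mono mult_right_mono multiplicity_fact_le)
       (auto simp: primes_upto_def dest: prime_gt_0_nat)
  also have "\<dots> = real n * mertens_sum (real n)"
    by (simp add: mertens_sum_def sum_distrib_left)
  finally have "real n * (ln (real n) - 1) \<le> real n * mertens_sum (real n)"
    by (simp add: algebra_simps)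
  then show ?thesis using assms by simp
qed

text \<open>\<open>ln (fact n) <= n * ln n\<close> is compared with Legendre's formula cut down to
  first powers. Rounding \<open>n / p\<close> down costs at most \<open>ln p\<close> per prime,
  \<open>n * ln 4\<close> in all by Chebyshev; passing from \<open>p\<close> to \<open>p - 1\<close>
  costs the convergent series.\<close>

lemma mertens_sum_le:
  assumes "n \<ge> 1"
  shows "mertens_sum (real n) \<le> ln (real n) + ln 4 + (\<Sum>k. ln (real k) / (real k * (real k - 1)))"
proof -
  let ?X = "primes_upto (real n)"
  have "(\<Sum>p\<in>?X. (real n / real p - 1) * ln (real p)) \<le> ln (fact n)"
    unfolding ln_fact_eq
    by (intro sum_mono mult_right_mono multiplicity_fact_ge)
       (auto simp: primes_upto_def dest: prime_gt_0_nat)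
  also have "\<dots> \<le> ln (real (n ^ n))"
    using fact_le_power[of n, where 'a = real] assms
    by (subst ln_le_cancel_iff) auto
  also have "\<dots> = real n * ln (real n)" using assms by (simp add: ln_realpow)
  finally have "real n * (\<Sum>p\<in>?X. ln (real p) / real p) - (\<Sum>p\<in>?X. ln (real p)) \<le> real n * ln (real n)"
    by (simp add: algebra_simps sum_subtractf sum_distrib_left)
  then have "real n * (\<Sum>p\<in>?X. ln (real p) / real p) \<le> real n * (ln (real n) + ln 4)"
    using sum_ln_primes_le[of n] by (simp add: algebra_simps)
  then have "(\<Sum>p\<in>?X. ln (real p) / real p) \<le> ln (real n) + ln 4" using assms by simp
  moreover have "mertens_sum (real n) = (\<Sum>p\<in>?X. ln (real p) / real p) + (\<Sum>p\<in>?X. ln (real p) / (real p * (real p - 1)))"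
    unfolding mertens_sum_def sum.distrib [symmetric]
    by (intro sum.cong refl) (auto dest!: prime_upto_ge_2 simp: field_simps)
  ultimately show ?thesis using sum_primes_ln_div_le[of ?X] by simp
qed

text \<open>Prime sums change only at integers, so the integer part of \<open>x\<close> decides; the
  logarithm moves by at most \<open>ln 2\<close> there, which the extra 1 in the constant
  absorbs.\<close>

lemma mertens_sum_bounded:
  obtains C where "C > 0" "\<And>x. x \<ge> 1 \<Longrightarrow> \<bar>mertens_sum x - ln x\<bar> \<le> C"
proof
  let ?C = "1 + ln 4 + (\<Sum>k. ln (real k) / (real k * (real k - 1)))"
  have "(\<Sum>k. ln (real k) / (real k * (real k - 1))) \<ge> 0"
    by (intro suminf_nonneg summable_ln_div ln_div_pronic_nonneg)
  then show "?C + 1 > 0" by (simp add: add_pos_nonneg)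
  fix x :: real assume x: "x \<ge> 1"
  define n where "n = nat \<lfloor>x\<rfloor>"
  have n: "n \<ge> 1" "real n \<le> x" "x \<le> real n + 1" using x unfolding n_def by linarith+
  have "real p \<le> x \<longleftrightarrow> p \<le> n" for p using x unfolding n_def by linarith
  then have "primes_upto x = primes_upto (real n)" by (simp add: primes_upto_def)
  then have eq: "mertens_sum x = mertens_sum (real n)" by (simp add: mertens_sum_def)
  have "ln (real n) \<le> ln x" using n by simp
  moreover have "ln x \<le> ln (2 * real n)" using n by (subst ln_le_cancel_iff) auto
  then have "ln x \<le> ln 2 + ln (real n)" using n by (simp add: ln_mult)
  moreover have "ln 2 \<le> (1::real)" using ln_2_less_1 by simp
  moreover have "ln 4 \<ge> (0::real)" by simp
  ultimately show "\<bar>mertens_sum x - ln x\<bar> \<le> ?C + 1"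
    using mertens_sum_ge[OF n(1)] mertens_sum_le[OF n(1)]
      \<open>(\<Sum>k. ln (real k) / (real k * (real k - 1))) \<ge> 0\<close> unfolding eq abs_le_iff by linarith
qed

section \<open>Mertens' third theorem\<close>

text \<open>Abel's theorem. Multiplying by the geometric series gives the generating function of the
  partial sums \<open>S\<close>, so the deviation from the limit is \<open>1 - x\<close> times the
  series of \<open>(S k - L) * x ^ k\<close>. Finitely many of its terms are bounded by
  \<open>M\<close>, all others by \<open>e / 2 * x ^ k\<close>.\<close>

lemma abel_limit:
  fixes a :: "nat \<Rightarrow> real"
  assumes "summable a"
  shows "((\<lambda>x. \<Sum>n. a n * x ^ n) \<longlongrightarrow> suminf a) (at_left 1)"
proof (rule tendstoI)
  fix e :: real assume e: "e > 0"
  define S where "S = (\<lambda>n. \<Sum>k\<le>n. a k)"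
  define L where "L = suminf a"
  have SL: "S \<longlonglongrightarrow> L" using summable_LIMSEQ'[OF assms] by (simp add: S_def L_def)
  then have "(\<lambda>n. S n - L) \<longlonglongrightarrow> 0" by (simp add: LIM_zero)
  then have "Bseq (\<lambda>n. S n - L)" by (rule convergentI[THEN convergent_imp_Bseq])
  then obtain M where M: "M > 0" "\<And>n. \<bar>S n - L\<bar> \<le> M" by (auto simp: Bseq_def)
  obtain N where N: "\<And>n. n \<ge> N \<Longrightarrow> \<bar>S n - L\<bar> < e / 2"
    using LIMSEQ_D[OF SL, of "e / 2"] e by auto
  have bound: "\<bar>(\<Sum>n. a n * x ^ n) - L\<bar> \<le> (1 - x) * (M * real N) + e / 2" if x: "0 < x" "x < 1" for x
  proof -
    have "(\<lambda>n. a n) \<longlonglongrightarrow> 0" using assms by (rule summable_LIMSEQ_zero)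
    then have "Bseq a" by (rule convergentI[THEN convergent_imp_Bseq])
    then obtain K where K: "\<And>n. \<bar>a n\<bar> \<le> K" by (auto simp: Bseq_def)
    have geo: "summable (\<lambda>n. x ^ n)" using x by simp
    have "summable (\<lambda>n. norm (a n * x ^ n))"
      by (rule summable_comparison_test'[OF summable_mult[OF geo, of K], of 0])
         (use K x in \<open>auto simp: abs_mult intro!: mult_right_mono\<close>)
    moreover have "summable (\<lambda>n. norm (x ^ n))" using geo x by simp
    ultimately have "(\<lambda>k. \<Sum>i\<le>k. a i * x ^ i * x ^ (k - i)) sums ((\<Sum>n. a n * x ^ n) * (\<Sum>n. x ^ n))"
      by (rule Cauchy_product_sums)
    moreover have "(\<Sum>i\<le>k. a i * x ^ i * x ^ (k - i)) = S k * x ^ k" for k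
      by (simp add: S_def sum_distrib_right mult.assoc flip: power_add)
    ultimately have S: "(\<lambda>k. S k * x ^ k) sums ((\<Sum>n. a n * x ^ n) / (1 - x))"
      using x by (simp add: suminf_geometric field_simps)
    moreover have "(\<lambda>k. L * x ^ k) sums (L / (1 - x))"
      using sums_mult[OF geometric_sums[of x], of L] x by simp
    ultimately have D: "(\<lambda>k. (S k - L) * x ^ k) sums (((\<Sum>n. a n * x ^ n) - L) / (1 - x))"
      by (auto dest: sums_diff simp: algebra_simps diff_divide_distrib)
    define B where "B = (\<lambda>k. (if k < N then M else 0) + e / 2 * x ^ k)"
    have "(\<lambda>k. if k < N then M else 0) sums (\<Sum>k | k < N. M)" by (rule sums_If_finite) simp
    moreover have "(\<lambda>k. e / 2 * x ^ k) sums (e / 2 / (1 - x))"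
      using sums_mult[OF geometric_sums[of x], of "e / 2"] x by simp
    ultimately have B: "B sums (M * real N + e / 2 / (1 - x))"
      unfolding B_def by (auto dest: sums_add simp: mult.commute)
    have "\<bar>(S k - L) * x ^ k\<bar> \<le> B k" for k
    proof (cases "k < N")
      case True
      have "\<bar>S k - L\<bar> * x ^ k \<le> M * 1" using M x by (intro mult_mono power_le_one) auto
      moreover have "0 \<le> e / 2 * x ^ k" using e x by simp
      ultimately show ?thesis using True x by (simp add: B_def abs_mult)
    next
      case False
      then show ?thesis using N[of k] x by (auto simp: B_def abs_mult intro!: mult_right_mono)
    qed
    then have "-B k \<le> (S k - L) * x ^ k" "(S k - L) * x ^ k \<le> B k" for k
      by (meson abs_le_D1 abs_le_D2 minus_le_iff)+
    then have "\<bar>((\<Sum>n. a n * x ^ n) - L) / (1 - x)\<bar> \<le> M * real N + e / 2 / (1 - x)"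
      using sums_le[OF _ D B] sums_le[OF _ sums_minus[OF B] D]
      unfolding abs_le_iff by (metis minus_le_iff)
    then have "\<bar>(\<Sum>n. a n * x ^ n) - L\<bar> \<le> (M * real N + e / 2 / (1 - x)) * (1 - x)"
      using x by (simp only: abs_divide pos_divide_le_eq abs_of_pos diff_gt_0_iff_gt)
    also have "\<dots> = (1 - x) * (M * real N) + e / 2"
      using x by (simp add: field_simps)
    finally show ?thesis .
  qed
  have "((\<lambda>x. (1 - x) * (M * real N) + e / 2) \<longlongrightarrow> (1 - 1) * (M * real N) + e / 2) (at_left (1::real))"
    by (intro tendsto_intros)
  then have "eventually (\<lambda>x. (1 - x) * (M * real N) + e / 2 < e) (at_left (1::real))"
    by (rule order_tendstoD) (use e in auto)
  moreover have "eventually (\<lambda>x. 0 < x \<and> x < 1) (at_left (1::real))"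
    by (rule eventually_at_leftI[of 0]) auto
  ultimately show "eventually (\<lambda>x. dist (\<Sum>n. a n * x ^ n) (suminf a) < e) (at_left 1)"
  proof eventually_elim
    case (elim x)
    then show ?case using bound[of x] by (simp add: dist_real_def L_def)
  qed
qed

section \<open>Zeta near 1 and finite Euler products\<close>

lemma zeta_partial_le:
  assumes "\<sigma> > (0::real)"
  shows "(\<Sum>n<N. real (Suc n) powr (- (1 + \<sigma>))) \<le> 1 + 1 / \<sigma>"
proof -
  have step: "real (n + 1) powr (- (1 + \<sigma>)) \<le> (real n powr (-\<sigma>) - real (n + 1) powr (-\<sigma>)) / \<sigma>"
    if "n \<ge> 1" for n
  proof -
    \<comment> \<open>A discrete integral comparison: the ratio of \<open>n powr (-\<sigma>)\<close>
      to \<open>(n + 1) powr (-\<sigma>)\<close> is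
      \<open>exp (\<sigma> * ln ((n + 1) / n))\<close>, at least
      \<open>1 + \<sigma> / (n + 1)\<close>, so that the terms are bounded by telescoping
      differences.\<close>
    have "1 / real (n + 1) \<le> - ln (1 - 1 / real (n + 1))"
      using ln_add_one_self_le_self2[of "- (1 / real (n + 1))"] that by simp
    also have "\<dots> = ln (real (n + 1)) - ln (real n)"
      using that ln_div[of "real n" "real (n + 1)"] by (simp add: field_simps)
    finally have "1 + \<sigma> * (1 / real (n + 1)) \<le> 1 + \<sigma> * (ln (real (n + 1)) - ln (real n))"
      using assms by (intro add_left_mono mult_left_mono) auto
    also have "\<dots> \<le> exp (\<sigma> * (ln (real (n + 1)) - ln (real n)))" by (rule exp_ge_add_one_self)
    finally have "real (n + 1) powr (-\<sigma>) * (1 + \<sigma> * (1 / real (n + 1))) \<le>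
        real (n + 1) powr (-\<sigma>) * exp (\<sigma> * (ln (real (n + 1)) - ln (real n)))"
      by (rule mult_left_mono) simp
    also have "\<dots> = real n powr (-\<sigma>)"
      using that by (simp add: powr_def algebra_simps flip: exp_add)
    finally have "\<sigma> * (real (n + 1) powr (-\<sigma>) / real (n + 1)) \<le> real n powr (-\<sigma>) - real (n + 1) powr (-\<sigma>)"
      by (simp add: algebra_simps)
    moreover have "real (n + 1) powr (-\<sigma>) / real (n + 1) = real (n + 1) powr (- (1 + \<sigma>))"
      by (simp add: powr_diff powr_minus_divide powr_add powr_minus field_simps)
    ultimately have "\<sigma> * real (n + 1) powr (- (1 + \<sigma>)) \<le> real n powr (-\<sigma>) - real (n + 1) powr (-\<sigma>)"
      by metis
    then show ?thesis using assms by (simp only: pos_le_divide_eq mult.commute)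
  qed
  have "(\<Sum>n<Suc M. real (Suc n) powr (- (1 + \<sigma>))) \<le> 1 + (1 - real (Suc M) powr (-\<sigma>)) / \<sigma>" for M
  proof (induction M)
    case (Suc M)
    have "(\<Sum>n<Suc (Suc M). real (Suc n) powr (- (1 + \<sigma>))) =
        (\<Sum>n<Suc M. real (Suc n) powr (- (1 + \<sigma>))) + real (Suc M + 1) powr (- (1 + \<sigma>))"
      by simp
    also have "\<dots> \<le> 1 + (1 - real (Suc M) powr (-\<sigma>)) / \<sigma> +
        (real (Suc M) powr (-\<sigma>) - real (Suc M + 1) powr (-\<sigma>)) / \<sigma>"
      by (intro add_mono Suc step) auto
    also have "\<dots> = 1 + (1 - real (Suc (Suc M)) powr (-\<sigma>)) / \<sigma>"
      by (simp add: add.assoc flip: add_divide_distrib)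
    finally show ?case .
  qed auto
  moreover have "1 + (1 - real (Suc M) powr (-\<sigma>)) / \<sigma> \<le> 1 + 1 / \<sigma>" for M
    using assms by (simp add: divide_right_mono)
  ultimately have "(\<Sum>n<Suc M. real (Suc n) powr (- (1 + \<sigma>))) \<le> 1 + 1 / \<sigma>" for M
    using order.trans by blast
  then show ?thesis using assms by (cases N) auto
qed

lemma powr_summable_on: "s > 1 \<Longrightarrow> (\<lambda>n. real n powr (-s)) summable_on (UNIV::nat set)"
  by (rule norm_summable_imp_summable_on) (simp add: summable_real_powr_iff)

lemma infsum_powr_le:
  assumes "\<sigma> > (0::real)"
  shows "infsum (\<lambda>n. real n powr (- (1 + \<sigma>))) {n. n \<ge> 1} \<le> 1 + 1 / \<sigma>"
proof (rule infsum_le_finite_sums)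
  show "(\<lambda>n. real n powr (- (1 + \<sigma>))) summable_on {n. n \<ge> 1}"
    by (rule summable_on_subset_banach[OF powr_summable_on]) (use assms in auto)
  fix F :: "nat set" assume F: "finite F" "F \<subseteq> {n. n \<ge> 1}"
  obtain N where N: "F \<subseteq> {..N}" using F(1) finite_nat_iff_bounded_le by auto
  have "(\<Sum>n\<in>F. real n powr (- (1 + \<sigma>))) \<le> (\<Sum>n\<in>{1..N}. real n powr (- (1 + \<sigma>)))"
    by (rule sum_mono2) (use F N in auto)
  also have "\<dots> = (\<Sum>n<N. real (Suc n) powr (- (1 + \<sigma>)))"
    by (rule sum.reindex_bij_witness[of _ Suc "\<lambda>n. n - 1"]) auto
  finally show "(\<Sum>n\<in>F. real n powr (- (1 + \<sigma>))) \<le> 1 + 1 / \<sigma>"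
    using zeta_partial_le[OF assms, of N] by simp
qed

text \<open>One prime is removed at a time: a number free of the primes in \<open>X\<close> is
  either free of \<open>q\<close> too or \<open>q\<close> times a number free of \<open>X\<close>,
  and scaling by \<open>q\<close> multiplies the sum by \<open>q powr (-s)\<close>.\<close>

lemma euler_product_sieve:
  fixes s :: real
  assumes "finite X" "\<And>p. p \<in> X \<Longrightarrow> prime p" and s: "s > 1"
  shows "infsum (\<lambda>n. real n powr (-s)) {n. n \<ge> 1 \<and> (\<forall>p\<in>X. \<not> p dvd n)} =
           (\<Prod>p\<in>X. 1 - real p powr (-s)) * infsum (\<lambda>n. real n powr (-s)) {n. n \<ge> 1}"
  using assms(1,2)
proof (induction X)
  case (insert q X)
  let ?f = "\<lambda>n. real n powr (-s)"
  let ?A = "\<lambda>X. {n. n \<ge> 1 \<and> (\<forall>p\<in>X. \<not> p dvd n)}"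
  have summ: "?f summable_on B" for B
    by (rule summable_on_subset_banach[OF powr_summable_on[OF s]]) auto
  have q: "prime q" "q > 0" using insert.prems prime_gt_0_nat by auto
  have ndvd: "\<not> p dvd q" if "p \<in> X" for p
    using that insert.prems insert.hyps q(1) primes_dvd_imp_eq by blast
  have "?A X = ?A (insert q X) \<union> (\<lambda>n. q * n) ` ?A X" (is "_ = _ \<union> ?I")
  proof (intro equalityI subsetI)
    fix n assume n: "n \<in> ?A X"
    show "n \<in> ?A (insert q X) \<union> ?I"
    proof (cases "q dvd n")
      case True
      then obtain m where m: "n = q * m" by auto
      then have "m \<in> ?A X" using n q by auto
      then show ?thesis using m by auto
    qed (use n in auto)
  next
    fix n assume "n \<in> ?A (insert q X) \<union> ?I"
    then show "n \<in> ?A X"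
    proof
      assume "n \<in> ?I"
      then obtain m where m: "n = q * m" "m \<in> ?A X" by auto
      have "\<not> p dvd n" if "p \<in> X" for p
        using that m ndvd[OF that] insert.prems by (auto simp: prime_dvd_mult_iff)
      then show ?thesis using m q by auto
    qed auto
  qed
  then have "infsum ?f (?A X) = infsum ?f (?A (insert q X)) + infsum ?f ?I"
    by (subst \<open>?A X = _\<close>, intro infsum_Un_disjoint summ) auto
  also have "infsum ?f ?I = infsum (?f \<circ> (\<lambda>n. q * n)) (?A X)"
    by (rule infsum_reindex) (use q in \<open>auto simp: inj_on_def\<close>)
  also have "\<dots> = infsum (\<lambda>n. real q powr (-s) * ?f n) (?A X)"
    by (intro infsum_cong) (simp add: powr_mult)
  also have "\<dots> = real q powr (-s) * infsum ?f (?A X)"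
    by (rule infsum_cmult_right) (rule summ)
  finally have "infsum ?f (?A (insert q X)) = (1 - real q powr (-s)) * infsum ?f (?A X)"
    by (simp add: algebra_simps)
  then show ?case using insert by (simp add: mult.assoc)
qed simp

text \<open>The sieved zeta sum still contains \<open>n = 1\<close>, hence is at least 1. With
  \<open>infsum_powr_le\<close> for the full sum, the logarithm of this inequality is the
  claim.\<close>

lemma sum_ln_euler_le:
  assumes "finite X" "\<And>p. p \<in> X \<Longrightarrow> prime p" "\<sigma> > 0"
  shows "(\<Sum>p\<in>X. - ln (1 - real p powr (- (1 + \<sigma>)))) \<le> ln (1 + 1 / \<sigma>)"
proof -
  let ?f = "\<lambda>n. real n powr (- (1 + \<sigma>))"
  let ?A = "{n. n \<ge> 1 \<and> (\<forall>p\<in>X. \<not> p dvd n)}"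
  have pos: "0 < 1 - ?f p" if "p \<in> X" for p
  proof -
    have "real p > 1" using assms(2)[OF that] prime_gt_1_nat by simp
    then have "?f p < real p powr 0" using assms by (intro powr_less_mono) auto
    then show ?thesis using \<open>real p > 1\<close> by simp
  qed
  have "infsum ?f {1} \<le> infsum ?f ?A"
  proof (rule infsum_mono2)
    show "?f summable_on ?A"
      by (rule summable_on_subset_banach[OF powr_summable_on]) (use assms in auto)
    show "{1} \<subseteq> ?A" by (auto dest: assms(2))
  qed auto
  also have "\<dots> \<le> (\<Prod>p\<in>X. 1 - ?f p) * (1 + 1 / \<sigma>)"
    using infsum_powr_le[OF assms(3)] pos assms
    by (subst euler_product_sieve)
       (auto intro!: mult_left_mono prod_nonneg intro: less_imp_le simp del: minus_add_distrib)
  finally have "1 \<le> (\<Prod>p\<in>X. 1 - ?f p) * (1 + 1 / \<sigma>)" by simp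
  then have "ln 1 \<le> ln ((\<Prod>p\<in>X. 1 - ?f p) * (1 + 1 / \<sigma>))" by (intro ln_mono) auto
  also have "\<dots> = (\<Sum>p\<in>X. ln (1 - ?f p)) + ln (1 + 1 / \<sigma>)"
  proof -
    have "(\<Prod>p\<in>X. 1 - ?f p) > 0" by (rule prod_pos) (use pos in auto)
    moreover have "1 + 1 / \<sigma> > 0" using assms by (intro add_pos_pos) auto
    moreover have "ln (\<Prod>p\<in>X. 1 - ?f p) = (\<Sum>p\<in>X. ln (1 - ?f p))"
      by (rule ln_prod) (use pos assms(1) in \<open>auto, metis less_irrefl\<close>)
    ultimately show ?thesis by (simp add: ln_mult_pos)
  qed
  finally show ?thesis by (simp add: sum_negf)
qed

text \<open>With \<open>u = 1 / p\<close> and \<open>s = p powr (-\<sigma>)\<close>, this moves the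
  weight \<open>s\<close> from inside the logarithm to the front. Both expressions have first-order
  term \<open>u * s\<close>, so the error is of second order in \<open>u\<close>, with the small
  factor \<open>1 - s\<close>.\<close>

lemma ln_euler_factor_compare:
  fixes u s :: real
  assumes "0 < u" "u < 1" "0 < s" "s \<le> 1"
  shows "- s * ln (1 - u) + ln (1 - u * s) \<le> (1 - s) * (u\<^sup>2 / (1 - u))"
proof -
  have "u * s \<le> u * 1" using assms by (intro mult_left_mono) auto
  also have "\<dots> < 1" using assms by simp
  finally have us: "u * s < 1" .
  have "ln (1 - u * s) - ln (1 - u) = ln ((1 - u * s) / (1 - u))"
    using assms us by (subst ln_div) auto
  also have "(1 - u * s) / (1 - u) = 1 + u * (1 - s) / (1 - u)"
    using assms by (simp add: field_simps)
  also have "ln \<dots> \<le> u * (1 - s) / (1 - u)"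
    by (rule ln_add_one_self_le_self) (use assms in auto)
  finally have 1: "ln (1 - u * s) \<le> ln (1 - u) + u * (1 - s) / (1 - u)" by simp
  have "ln (1 + (-u)) \<le> -u" using ln_add_one_self_le_self2[of "-u"] assms by simp
  then have "(1 - s) * ln (1 - u) \<le> (1 - s) * (- u)"
    by (intro mult_left_mono) (use assms in auto)
  then have "- s * ln (1 - u) + ln (1 - u * s) \<le> (1 - s) * (- u) + u * (1 - s) / (1 - u)"
    using 1 by (simp add: algebra_simps)
  also have "\<dots> = (1 - s) * (u\<^sup>2 / (1 - u))"
    using assms by (simp add: field_simps power2_eq_square)
  finally show ?thesis .
qed

lemma ln_euler_factor_bounds:
  assumes "prime p"
  shows "1 / real p \<le> - ln (1 - 1 / real p)" "- ln (1 - 1 / real p) \<le> 1 / (real p - 1)"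
proof -
  have p: "real p \<ge> 2" using prime_ge_2_nat[OF assms] by simp
  show "1 / real p \<le> - ln (1 - 1 / real p)"
    using ln_add_one_self_le_self2[of "- (1 / real p)"] p by simp
  have "- ln (1 - 1 / real p) = ln (1 + 1 / (real p - 1))"
    using p by (subst ln_inverse [symmetric]) (auto simp: field_simps)
  also have "\<dots> \<le> 1 / (real p - 1)" by (rule ln_add_one_self_le_self) (use p in auto)
  finally show "- ln (1 - 1 / real p) \<le> 1 / (real p - 1)" .
qed

text \<open>Keeping the weight \<open>p powr (-\<sigma>)\<close> as a factor makes the sum
  comparable, block by block, with a power series in \<open>exp (-\<sigma>)\<close>. Since
  \<open>1 - p powr (-\<sigma>) <= \<sigma> * ln p\<close>, the total exchange error is a constant
  times \<open>\<sigma>\<close>.\<close>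

lemma sum_ln_euler_powr_le:
  assumes "\<sigma> > 0"
  shows "(\<Sum>p\<in>primes_upto x. - ln (1 - 1 / real p) * real p powr (-\<sigma>)) \<le>
           ln (1 + 1 / \<sigma>) + \<sigma> * (\<Sum>k. ln (real k) / (real k * (real k - 1)))"
proof -
  have "- ln (1 - 1 / real p) * real p powr (-\<sigma>) \<le>
      - ln (1 - real p powr (- (1 + \<sigma>))) + \<sigma> * (ln (real p) / (real p * (real p - 1)))"
    if "p \<in> primes_upto x" for p
  proof -
    have p: "real p \<ge> 2" using that by (rule prime_upto_ge_2)
    define s where "s = real p powr (-\<sigma>)"
    have "s \<le> real p powr 0" unfolding s_def using p assms by (intro powr_mono) auto
    then have s: "0 < s" "s \<le> 1" using p by (auto simp: s_def)
    have "1 + (- \<sigma> * ln (real p)) \<le> s"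
      using p exp_ge_add_one_self[of "- \<sigma> * ln (real p)"] by (simp add: s_def powr_def)
    then have "1 - s \<le> \<sigma> * ln (real p)" by simp
    then have "(1 - s) * ((1 / real p)\<^sup>2 / (1 - 1 / real p)) \<le> \<sigma> * ln (real p) * ((1 / real p)\<^sup>2 / (1 - 1 / real p))"
      by (rule mult_right_mono) (use p in auto)
    moreover have "(1 / real p)\<^sup>2 / (1 - 1 / real p) = 1 / (real p * (real p - 1))"
      using p by (simp add: divide_simps power2_eq_square)
    ultimately have "(1 - s) * ((1 / real p)\<^sup>2 / (1 - 1 / real p)) \<le> \<sigma> * (ln (real p) / (real p * (real p - 1)))"
      by simp
    moreover have "1 / real p * s = real p powr (- (1 + \<sigma>))"
      using p by (simp add: s_def powr_add powr_minus powr_diff field_simps)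
    ultimately show ?thesis
      using ln_euler_factor_compare[of "1 / real p" s] p s by (simp add: s_def mult.commute)
  qed
  then have "(\<Sum>p\<in>primes_upto x. - ln (1 - 1 / real p) * real p powr (-\<sigma>)) \<le>
      (\<Sum>p\<in>primes_upto x. - ln (1 - real p powr (- (1 + \<sigma>))) + \<sigma> * (ln (real p) / (real p * (real p - 1))))"
    by (rule sum_mono)
  also have "\<dots> = (\<Sum>p\<in>primes_upto x. - ln (1 - real p powr (- (1 + \<sigma>)))) +
      \<sigma> * (\<Sum>p\<in>primes_upto x. ln (real p) / (real p * (real p - 1)))"
    by (simp only: sum.distrib sum_distrib_left)
  also have "\<dots> \<le> ln (1 + 1 / \<sigma>) + \<sigma> * (\<Sum>k. ln (real k) / (real k * (real k - 1)))"
    by (intro add_mono mult_left_mono sum_ln_euler_le sum_primes_ln_div_le)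
       (use assms in \<open>auto simp: primes_upto_def[of x] intro: finite_primes_upto[of x, unfolded primes_upto_def]\<close>)
  finally show ?thesis .
qed

section \<open>Blocks of primes on the logarithmic scale\<close>

definition mertens_log :: "real \<Rightarrow> real" where
  "mertens_log x = (\<Sum>p\<in>primes_upto x. - ln (1 - 1 / real p))"

text \<open>Primes with \<open>n < ln p <= n + 1\<close>. Within a block \<open>ln p\<close> is
  within 1 of \<open>n + 1\<close>, so dividing \<open>ln p / (p - 1)\<close> by
  \<open>n + 1\<close> approximates \<open>1 / (p - 1)\<close>.\<close>

definition prime_block :: "nat \<Rightarrow> nat set" where
  "prime_block n = primes_upto (exp (real (Suc n))) - primes_upto (exp (real n))"

lemma finite_prime_block [simp, intro]: "finite (prime_block n)"
  by (simp add: prime_block_def)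

lemma prime_blockD:
  assumes "p \<in> prime_block n"
  shows "prime p" "real n \<le> ln (real p)" "ln (real p) \<le> real (Suc n)" "real p \<ge> 2"
proof -
  show p: "prime p" using assms by (simp add: prime_block_def primes_upto_def)
  show p2: "real p \<ge> 2" using prime_ge_2_nat[OF p] by simp
  have "exp (real n) < real p" "real p \<le> exp (real (Suc n))"
    using assms by (auto simp: prime_block_def primes_upto_def)
  then have "ln (exp (real n)) \<le> ln (real p)" "ln (real p) \<le> ln (exp (real (Suc n)))"
    using p2 by (subst ln_le_cancel_iff; simp)+
  then show "real n \<le> ln (real p)" "ln (real p) \<le> real (Suc n)" by simp_all
qed

lemma sum_prime_block_Suc:
  "sum f (primes_upto (exp (real (Suc n)))) = sum f (primes_upto (exp (real n))) + sum f (prime_block n)"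
  unfolding prime_block_def
  by (subst sum.subset_diff[of "primes_upto (exp (real n))"]) (auto intro!: primes_upto_mono simp: add.commute)

lemma sum_prime_blocks:
  "(\<Sum>n<N. sum f (prime_block n)) = sum f (primes_upto (exp (real N)))"
proof (induction N)
  case 0
  have "primes_upto (exp (real 0)) = {}" by (auto simp: primes_upto_def dest: prime_gt_1_nat)
  then show ?case by simp
next
  case (Suc N)
  then show ?case using sum_prime_block_Suc[of f N] by simp
qed

text \<open>With the bounded remainder \<open>R\<close> of Mertens' first theorem, a block sum minus
  1 is \<open>R (Suc n) - R n\<close>. Summation by parts moves the difference onto
  \<open>1 / real (Suc n)\<close>, leaving an absolutely convergent series.\<close>

lemma summable_mertens_block:
  "summable (\<lambda>n. ((\<Sum>p\<in>prime_block n. ln (real p) / (real p - 1)) - 1) / real (Suc n))"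
proof -
  define R where "R = (\<lambda>n. mertens_sum (exp (real n)) - real n)"
  obtain C where C: "C > 0" "\<And>x. x \<ge> 1 \<Longrightarrow> \<bar>mertens_sum x - ln x\<bar> \<le> C"
    using mertens_sum_bounded by blast
  have R: "\<bar>R n\<bar> \<le> C" for n using C(2)[of "exp (real n)"] by (simp add: R_def)
  have R0: "R 0 = 0" using sum_prime_blocks[of "\<lambda>p. ln (real p) / (real p - 1)" 0]
    by (simp add: R_def mertens_sum_def)
  have b: "(\<Sum>p\<in>prime_block n. ln (real p) / (real p - 1)) - 1 = R (Suc n) - R n" for n
    using sum_prime_block_Suc[of "\<lambda>p. ln (real p) / (real p - 1)" n] by (simp add: R_def mertens_sum_def)
  have abel: "(\<Sum>n<N. (R (Suc n) - R n) / real (Suc n)) =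
      R N / real (Suc N) + (\<Sum>n<N. R (Suc n) * (1 / (real (Suc n) * real (Suc (Suc n)))))" for N
  proof (induction N)
    case (Suc N)
    have "R N / real (Suc N) + (R (Suc N) - R N) / real (Suc N) =
        R (Suc N) / real (Suc (Suc N)) + R (Suc N) * (1 / (real (Suc N) * real (Suc (Suc N))))"
      by (simp add: divide_simps) (simp add: algebra_simps)
    then show ?case using Suc by simp
  qed (simp add: R0)
  have "(\<lambda>N. R N / real (Suc N)) \<longlonglongrightarrow> 0"
  proof (rule Lim_null_comparison)
    show "\<forall>\<^sub>F N in sequentially. norm (R N / real (Suc N)) \<le> C / real (Suc N)"
      using R by (intro always_eventually allI) (simp add: divide_right_mono)
    show "(\<lambda>N. C / real (Suc N)) \<longlonglongrightarrow> 0" by real_asymp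
  qed
  then have c1: "convergent (\<lambda>N. R N / real (Suc N))" by (rule convergentI)
  have "summable (\<lambda>n. R (Suc n) * (1 / (real (Suc n) * real (Suc (Suc n)))))"
  proof (rule summable_comparison_test')
    have "summable (\<lambda>n. 1 / (real (n + 2) * (real (n + 2) - 1)))"
      using summable_inverse_pronic by (subst summable_iff_shift)
    then show "summable (\<lambda>n. C * (1 / (real (n + 2) * (real (n + 2) - 1))))" by (rule summable_mult)
    fix n :: nat
    show "norm (R (Suc n) * (1 / (real (Suc n) * real (Suc (Suc n))))) \<le> C * (1 / (real (n + 2) * (real (n + 2) - 1)))"
      using R[of "Suc n"] by (simp add: abs_mult divide_right_mono mult.commute add_ac)
  qed
  then have c2: "convergent (\<lambda>N. \<Sum>n<N. R (Suc n) * (1 / (real (Suc n) * real (Suc (Suc n)))))"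
    by (simp only: summable_iff_convergent)
  show ?thesis unfolding b summable_iff_convergent abel by (rule convergent_add[OF c1 c2])
qed

text \<open>There are two errors per prime: \<open>- ln (1 - 1 / p)\<close> lies within
  \<open>1 / (p * (p - 1))\<close> of \<open>1 / (p - 1)\<close>, and \<open>ln p / (n + 1)\<close>
  within \<open>1 / (n + 1)\<close> of 1. As \<open>ln p >= n\<close>, the second is at most a
  fraction \<open>1 / (n * (n + 1))\<close> of the block sum of \<open>ln p / (p - 1)\<close>, which
  is bounded.\<close>

lemma summable_mertens_log_block_diff:
  "summable (\<lambda>n. (\<Sum>p\<in>prime_block n. - ln (1 - 1 / real p)) -
      (\<Sum>p\<in>prime_block n. ln (real p) / (real p - 1)) / real (Suc n))"
proof -
  define b where "b = (\<lambda>n. \<Sum>p\<in>prime_block n. ln (real p) / (real p - 1))"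
  define e where "e = (\<lambda>n. \<Sum>p\<in>prime_block n. 1 / (real p * (real p - 1)))"
  obtain C where C: "C > 0" "\<And>x. x \<ge> 1 \<Longrightarrow> \<bar>mertens_sum x - ln x\<bar> \<le> C"
    using mertens_sum_bounded by blast
  have bC: "b n \<le> 1 + 2 * C" for n
  proof -
    have "b n = mertens_sum (exp (real (Suc n))) - mertens_sum (exp (real n))"
      using sum_prime_block_Suc[of "\<lambda>p. ln (real p) / (real p - 1)" n] by (simp add: b_def mertens_sum_def)
    moreover have "\<bar>mertens_sum (exp (real (Suc n))) - real (Suc n)\<bar> \<le> C" "\<bar>mertens_sum (exp (real n)) - real n\<bar> \<le> C"
      using C(2)[of "exp (real (Suc n))"] C(2)[of "exp (real n)"] by simp_all
    ultimately show ?thesis by linarith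
  qed
  have "summable e"
  proof (rule summableI_nonneg_bounded)
    show "e n \<ge> 0" for n unfolding e_def by (intro sum_nonneg inverse_pronic_nonneg)
    show "(\<Sum>n<N. e n) \<le> (\<Sum>k. 1 / (real k * (real k - 1)))" for N
      unfolding e_def sum_prime_blocks by (rule sum_primes_inverse_pronic_le) simp
  qed
  moreover have "summable (\<lambda>n. (1 + 2 * C) * (1 / (real (n + 1) * (real (n + 1) - 1))))"
    using summable_inverse_pronic by (intro summable_mult, subst summable_iff_shift)
  ultimately have "summable (\<lambda>n. e n + (1 + 2 * C) * (1 / (real (n + 1) * (real (n + 1) - 1))))"
    by (rule summable_add)
  moreover have "\<bar>(\<Sum>p\<in>prime_block n. - ln (1 - 1 / real p)) - b n / real (Suc n)\<bar> \<le>
      e n + (1 + 2 * C) * (1 / (real (n + 1) * (real (n + 1) - 1)))" if n: "n \<ge> 1" for n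
  proof -
    have "\<bar>- ln (1 - 1 / real p) - ln (real p) / (real p - 1) / real (Suc n)\<bar> \<le>
        1 / (real p * (real p - 1)) + ln (real p) / (real p - 1) * (1 / (real (n + 1) * real n))"
      if p: "p \<in> prime_block n" for p
    proof -
      note p = prime_blockD[OF p]
      define v where "v = 1 / (real p - 1)"
      define l where "l = ln (real p)"
      have v: "v > 0" using p by (simp add: v_def)
      have l: "real n \<le> l" "l \<le> real n + 1" using p by (auto simp: l_def)
      have "1 / real p = v - 1 / (real p * (real p - 1))"
        using p by (simp add: v_def divide_simps)
      then have 1: "v - 1 / (real p * (real p - 1)) \<le> - ln (1 - 1 / real p)" "- ln (1 - 1 / real p) \<le> v"
        using ln_euler_factor_bounds[OF p(1)] by (auto simp: v_def)
      have "v * (l / (real n + 1)) \<le> v * 1" using v l by (intro mult_left_mono) auto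
      moreover have "v * (1 - l / (real n + 1)) \<le> v * (l * (1 / ((real n + 1) * real n)))"
      proof (rule mult_left_mono)
        have "1 - l / (real n + 1) = (real n + 1 - l) / (real n + 1)"
          by (simp add: diff_divide_distrib)
        also have "\<dots> \<le> 1 / (real n + 1)" using l by (intro divide_right_mono) auto
        also have "\<dots> \<le> l / real n * (1 / (real n + 1))"
          using l n mult_right_mono[of 1 "l / real n" "1 / (real n + 1)"] by simp
        also have "\<dots> = l * (1 / ((real n + 1) * real n))" by simp
        finally show "1 - l / (real n + 1) \<le> l * (1 / ((real n + 1) * real n))" .
      qed (use v in simp)
      moreover have "0 \<le> 1 / (real p * (real p - 1))" by (rule inverse_pronic_nonneg)
      moreover have "0 \<le> v * (l * (1 / ((real n + 1) * real n)))" using v l by simp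
      moreover have "ln (real p) / (real p - 1) / real (Suc n) = v * (l / (real n + 1))"
        "ln (real p) / (real p - 1) * (1 / (real (n + 1) * real n)) = v * (l * (1 / ((real n + 1) * real n)))"
        by (simp_all add: v_def l_def add.commute)
      moreover have "v * (1 - l / (real n + 1)) = v - v * (l / (real n + 1))" "v * 1 = v"
        by (simp_all add: right_diff_distrib)
      ultimately show ?thesis using 1 unfolding abs_le_iff by linarith
    qed
    then have "\<bar>\<Sum>p\<in>prime_block n. - ln (1 - 1 / real p) - ln (real p) / (real p - 1) / real (Suc n)\<bar> \<le>
      (\<Sum>p\<in>prime_block n. 1 / (real p * (real p - 1)) + ln (real p) / (real p - 1) * (1 / (real (n + 1) * real n)))"
      by (intro order.trans[OF sum_abs] sum_mono)
    then have "\<bar>(\<Sum>p\<in>prime_block n. - ln (1 - 1 / real p)) - b n / real (Suc n)\<bar> \<le>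
        e n + b n * (1 / (real (n + 1) * real n))"
      by (simp only: sum_subtractf sum.distrib b_def e_def sum_divide_distrib sum_distrib_right)
    also have "b n * (1 / (real (n + 1) * real n)) \<le> (1 + 2 * C) * (1 / (real (n + 1) * real n))"
      by (intro mult_right_mono bC) auto
    finally show ?thesis by simp
  qed
  ultimately have "summable (\<lambda>n. (\<Sum>p\<in>prime_block n. - ln (1 - 1 / real p)) - b n / real (Suc n))"
    unfolding real_norm_def [symmetric] by (rule summable_comparison_test')
  then show ?thesis by (simp add: b_def)
qed

lemma summable_mertens_log_block:
  "summable (\<lambda>n. (\<Sum>p\<in>prime_block n. - ln (1 - 1 / real p)) - 1 / real (Suc n))"
  using summable_add[OF summable_mertens_block summable_mertens_log_block_diff]
  by (simp add: diff_divide_distrib)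

text \<open>With \<open>x = e\<^sup>-\<^sup>\<sigma>\<close>, the power series of these terms is at most \<open>log \<zeta>(1 + \<sigma>) + log (1 - x) + O(\<sigma>)\<close>,
  which tends to \<open>0\<close> as \<open>\<sigma> \<rightarrow> 0\<close>; Abel's theorem gives the value at \<open>x = 1\<close>.\<close>
lemma mertens_log_block_sum_le:
  "(\<Sum>n. (\<Sum>p\<in>prime_block n. - ln (1 - 1 / real p)) - 1 / real (Suc n)) \<le> 0"
proof -
  define a where "a = (\<lambda>n. \<Sum>p\<in>prime_block n. - ln (1 - 1 / real p))"
  define d where "d = (\<lambda>n. a n - 1 / real (Suc n))"
  define C where "C = (\<Sum>k. ln (real k) / (real k * (real k - 1)))"
  have sd: "summable d" unfolding d_def a_def by (rule summable_mertens_log_block)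
  have a0: "a n \<ge> 0" for n
  proof -
    have "0 \<le> - ln (1 - 1 / real p)" if "p \<in> prime_block n" for p
    proof -
      have "0 \<le> 1 / real p" by simp
      then show ?thesis using ln_euler_factor_bounds(1)[OF prime_blockD(1)[OF that]] by linarith
    qed
    then show ?thesis unfolding a_def by (rule sum_nonneg)
  qed
  have upper: "exp (-\<sigma>) * (\<Sum>n. d n * exp (-\<sigma>) ^ n) \<le> ln (1 + 1 / \<sigma>) + \<sigma> * C + ln (1 - exp (-\<sigma>))"
    if \<sigma>: "\<sigma> > 0" for \<sigma> :: real
  proof -
    define x where "x = exp (-\<sigma>)"
    have x: "0 < x" "x < 1" using \<sigma> by (auto simp: x_def)
    have "(\<Sum>n<N. a n * x ^ Suc n) \<le> ln (1 + 1 / \<sigma>) + \<sigma> * C" for N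
    proof -
      \<comment> \<open>In block \<open>n\<close> one has \<open>ln p <= n + 1\<close>, so the
        exponent \<open>Suc n\<close> ensures \<open>x ^ Suc n <= p powr (-\<sigma>)\<close>; the
        extra factor \<open>x\<close> tends to 1.\<close>
      have "a n * x ^ Suc n \<le> (\<Sum>p\<in>prime_block n. - ln (1 - 1 / real p) * real p powr (-\<sigma>))" for n
        unfolding a_def sum_distrib_right
      proof (rule sum_mono)
        fix p assume p: "p \<in> prime_block n"
        note p = prime_blockD[OF p]
        have "x ^ Suc n = exp (- \<sigma> * real (Suc n))"
          by (simp only: x_def flip: exp_of_nat_mult) (simp add: mult.commute)
        also have "\<dots> \<le> exp (- \<sigma> * ln (real p))"
          using p \<sigma> by simp
        also have "\<dots> = real p powr (-\<sigma>)" using p by (simp add: powr_def)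
        finally have "x ^ Suc n \<le> real p powr (-\<sigma>)" .
        moreover have "0 \<le> 1 / real p" by simp
        then have "0 \<le> - ln (1 - 1 / real p)"
          using ln_euler_factor_bounds(1)[OF p(1)] by linarith
        ultimately show "- ln (1 - 1 / real p) * x ^ Suc n \<le> - ln (1 - 1 / real p) * real p powr (-\<sigma>)"
          by (rule mult_left_mono)
      qed
      then have "(\<Sum>n<N. a n * x ^ Suc n) \<le>
          (\<Sum>n<N. \<Sum>p\<in>prime_block n. - ln (1 - 1 / real p) * real p powr (-\<sigma>))"
        by (rule sum_mono)
      also have "\<dots> \<le> ln (1 + 1 / \<sigma>) + \<sigma> * C"
        unfolding sum_prime_blocks C_def by (rule sum_ln_euler_powr_le[OF \<sigma>])
      finally show ?thesis .
    qed
    note partial = this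
    have sa: "summable (\<lambda>n. a n * x ^ Suc n)"
      by (rule summableI_nonneg_bounded[OF _ partial]) (use a0 x in simp)
    moreover have "(\<Sum>n. a n * x ^ Suc n) \<le> ln (1 + 1 / \<sigma>) + \<sigma> * C"
      by (rule suminf_le_const[OF sa partial])
    moreover have ser: "(\<lambda>n. 1 / real (Suc n) * x ^ Suc n) sums (- ln (1 - x))"
    proof -
      have "(\<lambda>n. - (x ^ n / real n)) sums ln (1 - x)"
        using ln_series'[of "- x"] x by simp
      from sums_minus[OF this] have "(\<lambda>n. x ^ n / real n) sums (- ln (1 - x))" by simp
      \<comment> \<open>The term of index 0 has denominator 0 and hence value 0, so shifting the
        index keeps the sum.\<close>
      then have "(\<lambda>n. x ^ Suc n / real (Suc n)) sums (- ln (1 - x))"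
        by (subst sums_Suc_iff) simp
      then show ?thesis by simp
    qed
    ultimately have "(\<Sum>n. a n * x ^ Suc n - 1 / real (Suc n) * x ^ Suc n) \<le> ln (1 + 1 / \<sigma>) + \<sigma> * C + ln (1 - x)"
      using sums_diff[OF summable_sums[OF sa] ser] by (simp add: sums_iff)
    also have "(\<lambda>n. a n * x ^ Suc n - 1 / real (Suc n) * x ^ Suc n) = (\<lambda>n. x * (d n * x ^ n))"
      by (simp add: d_def algebra_simps)
    also have "(\<Sum>n. x * (d n * x ^ n)) = x * (\<Sum>n. d n * x ^ n)"
    proof (rule suminf_mult)
      have "summable (\<lambda>n. x * (d n * x ^ n))"
        using sums_diff[OF summable_sums[OF sa] ser]
        by (simp add: sums_iff d_def algebra_simps)
      then show "summable (\<lambda>n. d n * x ^ n)" using x by (simp add: summable_cmult_iff)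
    qed
    finally show ?thesis by (simp add: x_def)
  qed
  \<comment> \<open>\<open>ln (1 + 1 / \<sigma>)\<close> behaves like \<open>- ln \<sigma>\<close>
    and \<open>ln (1 - exp (-\<sigma>))\<close> like \<open>ln \<sigma>\<close>; the two
    singularities cancel.\<close>
  have lim1: "((\<lambda>\<sigma>. ln (1 + 1 / \<sigma>) + \<sigma> * C + ln (1 - exp (-\<sigma>))) \<longlongrightarrow> 0) (at_right (0::real))"
    by real_asymp
  have "filterlim (\<lambda>\<sigma>::real. exp (-\<sigma>)) (at_left 1) (at_right 0)"
    by real_asymp
  then have "((\<lambda>\<sigma>. exp (-\<sigma>) * (\<Sum>n. d n * exp (-\<sigma>) ^ n)) \<longlongrightarrow> exp (-0) * suminf d) (at_right (0::real))"
    by (intro tendsto_mult filterlim_compose[OF abel_limit[OF sd]]) (auto intro!: tendsto_eq_intros)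
  then have "exp (-0) * suminf d \<le> 0"
    by (rule tendsto_le[rotated, OF lim1])
       (use upper in \<open>auto intro!: eventually_at_rightI[of 0 1]\<close>)
  then show ?thesis by (simp add: d_def a_def)
qed

text \<open>The harmonic numbers from the block comparison bring in Euler's constant. The inequality
  for \<open>L\<close> bounds Mertens' product from below, the direction that a lower bound for
  \<open>d_t\<close> requires; convergence gives the boundedness used in the average bound.\<close>

lemma mertens_log_minus_ln_convergent:
  obtains L where "(\<lambda>N. mertens_log (exp (real N)) - ln (real N)) \<longlonglongrightarrow> L" "L \<le> euler_mascheroni"
proof
  let ?d = "\<lambda>n. (\<Sum>p\<in>prime_block n. - ln (1 - 1 / real p)) - 1 / real (Suc n)"
  have "(\<Sum>n<N. ?d n) = mertens_log (exp (real N)) - harm N" for N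
    unfolding sum_subtractf sum_prime_blocks by (simp add: mertens_log_def harm_altdef inverse_eq_divide)
  then have "(\<lambda>N. mertens_log (exp (real N)) - harm N) \<longlonglongrightarrow> suminf ?d"
    using summable_LIMSEQ[OF summable_mertens_log_block] by simp
  from tendsto_add[OF this euler_mascheroni_LIMSEQ]
  show "(\<lambda>N. mertens_log (exp (real N)) - ln (real N)) \<longlonglongrightarrow> suminf ?d + euler_mascheroni" by simp
  show "suminf ?d + euler_mascheroni \<le> (euler_mascheroni :: real)"
    using mertens_log_block_sum_le by simp
qed

lemma prod_primes_eq_exp_mertens_log:
  "(\<Prod>p\<in>primes_upto x. 1 - 1 / real p) = exp (- mertens_log x)"
proof -
  have "exp (- mertens_log x) = (\<Prod>p\<in>primes_upto x. exp (ln (1 - 1 / real p)))"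
    by (simp add: mertens_log_def sum_negf exp_sum)
  also have "\<dots> = (\<Prod>p\<in>primes_upto x. 1 - 1 / real p)"
    by (intro prod.cong) (auto dest!: prime_upto_ge_2)
  finally show ?thesis by simp
qed

lemma mertens_log_mono: "x \<le> y \<Longrightarrow> mertens_log x \<le> mertens_log y"
  unfolding mertens_log_def
proof (intro sum_mono2 primes_upto_mono)
  fix p assume "p \<in> primes_upto y - primes_upto x"
  then have "1 / real p \<le> - ln (1 - 1 / real p)"
    by (intro ln_euler_factor_bounds) (simp add: primes_upto_def)
  moreover have "0 \<le> 1 / real p" by simp
  ultimately show "0 \<le> - ln (1 - 1 / real p)" by linarith
qed auto

section \<open>Lower bound from practical numbers\<close>

text \<open>\<open>d div gcd d m\<close> is coprime to \<open>m div gcd d m\<close>, hence divides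
  \<open>r\<close>; it is not 1 because \<open>d\<close> does not divide \<open>m\<close>, so some
  prime factor of \<open>r\<close> divides \<open>d\<close>.\<close>

lemma dvd_mult_large:
  fixes d m r k :: nat
  assumes "d dvd m * r" "\<not> d dvd m" "m > 0" "r > 0"
    and "\<And>p. prime p \<Longrightarrow> p dvd r \<Longrightarrow> k < p"
  shows "k < d"
proof -
  define g where "g = gcd d m"
  have g: "g > 0" using assms by (simp add: g_def)
  have d: "d = g * (d div g)" and m: "m = g * (m div g)" by (simp_all add: g_def)
  have "coprime (d div g) (m div g)" using assms unfolding g_def by (intro div_gcd_coprime) auto
  moreover have "d div g dvd m div g * r"
    using assms(1) g by (metis d m dvd_times_left_cancel_iff mult.assoc neq0_conv)
  ultimately have "d div g dvd r" by (simp add: coprime_dvd_mult_right_iff)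
  moreover have "d div g \<noteq> 1"
    using assms(2) d m by (metis dvd_triv_left mult.right_neutral)
  then obtain p where p: "prime p" "p dvd d div g" using prime_factor_nat by blast
  ultimately have "k < p" using assms(5) dvd_trans by blast
  also have "d > 0" using assms(1,3,4) by (intro Nat.gr0I) auto
  then have "p \<le> d" using p(2) d by (metis dvd_imp_le dvd_mult)
  finally show ?thesis .
qed

text \<open>Otherwise \<open>\<sigma>(m) + 1 \<le> m'\<close> would not be a sum of distinct divisors of \<open>m'\<close>: those not
  dividing \<open>m\<close> are too large, and the others have sum at most \<open>\<sigma>(m)\<close>.\<close>
lemma practical_dvd_practical_part:
  assumes m': "practical m'" "m' dvd m * r" and "m > 0" "r > 0"
    and large: "\<And>p. prime p \<Longrightarrow> p dvd r \<Longrightarrow> \<Sum>{d. d dvd m} + 1 < p"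
  shows "m' dvd m"
proof (rule ccontr)
  define k where "k = \<Sum>{d. d dvd m} + 1"
  assume nd: "\<not> m' dvd m"
  have "k < m'" using dvd_mult_large[OF m'(2) nd] assms unfolding k_def by blast
  then have "k \<in> {1..m'}" by (auto simp: k_def)
  then obtain S where S: "S \<subseteq> {d. d dvd m'}" "\<Sum>S = k"
    using m'(1) unfolding practical_def sum_of_distinct_divisors_def by blast
  have "m' > 0" using \<open>k < m'\<close> by simp
  then have fin: "finite S" using S(1) finite_subset by fastforce
  have "S \<subseteq> {d. d dvd m}"
  proof
    fix d assume d: "d \<in> S"
    have "d \<le> k" using member_le_sum[of d S "\<lambda>x. x"] d fin S(2) by auto
    moreover have "d dvd m * r" using d S(1) m'(2) dvd_trans by blast
    ultimately show "d \<in> {d. d dvd m}"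
      using dvd_mult_large[of d m r k] assms unfolding k_def by fastforce
  qed
  then have "\<Sum>S \<le> \<Sum>{d. d dvd m}" using \<open>m > 0\<close> by (intro sum_mono2) auto
  then show False using S(2) by (simp add: k_def)
qed

lemma harm_le_1_plus_ln: "n \<ge> 1 \<Longrightarrow> harm n \<le> 1 + ln (real n)"
  using decseqD[OF decseq_harm_diff_ln, of 0 "n - 1"] by (simp add: harm_def)

text \<open>The involution sending \<open>d\<close> to \<open>m div d\<close> turns the divisor sum
  into \<open>m\<close> times a part of the harmonic sum.\<close>

lemma sum_divisors_le:
  assumes "m \<ge> 1"
  shows "real (\<Sum>{d. d dvd m}) \<le> real m * (1 + ln (real m))"
proof -
  have fin: "finite {d. d dvd m}" using assms by auto
  have "real (\<Sum>{d. d dvd m}) = (\<Sum>d | d dvd m. real d)" by simp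
  also have "\<dots> = (\<Sum>d | d dvd m. real m / real d)"
    by (rule sum.reindex_bij_witness[of _ "\<lambda>d. m div d" "\<lambda>d. m div d"])
       (use assms in \<open>auto simp: real_of_nat_div elim!: dvdE\<close>)
  also have "\<dots> \<le> (\<Sum>d=1..m. real m / real d)"
    by (rule sum_mono2) (use assms in \<open>auto simp: Suc_leI dvd_imp_le dvd_pos_nat\<close>)
  also have "\<dots> = real m * harm m" by (simp add: harm_def sum_distrib_left divide_inverse)
  also have "\<dots> \<le> real m * (1 + ln (real m))"
    using assms by (intro mult_left_mono harm_le_1_plus_ln) auto
  finally show ?thesis .
qed

lemma freq_practical_part:
  assumes "m \<ge> 1" "m * \<Prod>(primes_upto x) dvd Q" "Q > 0"
  shows "freq Q (\<lambda>n. m dvd n \<and> (\<forall>p\<in>primes_upto x. \<not> p dvd n div m)) = exp (- mertens_log x) / m"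
proof -
  have m: "m dvd Q" using assms(2) dvd_mult_left by blast
  have "freq (Q div m) (\<lambda>n. (\<forall>p\<in>{}. p dvd n) \<and> (\<forall>p\<in>primes_upto x. \<not> p dvd n)) =
      (\<Prod>p\<in>{}. 1 / real p) * (\<Prod>p\<in>primes_upto x. 1 - 1 / real p)"
  proof (rule freq_sieve)
    show "\<Prod>({} \<union> primes_upto x) dvd Q div m"
      using assms m by (simp add: dvd_div_iff_mult mult.commute)
    show "Q div m > 0" using m assms by (auto simp: div_greater_zero_iff dvd_imp_le)
    show "prime p" if "p \<in> {} \<union> primes_upto x" for p using that by (simp add: primes_upto_def)
  qed simp_all
  then have "freq (Q div m) (\<lambda>n. \<forall>p\<in>primes_upto x. \<not> p dvd n) = exp (- mertens_log x)"
    by (simp add: prod_primes_eq_exp_mertens_log)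
  then show ?thesis
    using freq_dvd_mult[OF m assms(3), of "\<lambda>n. \<forall>p\<in>primes_upto x. \<not> p dvd n"] by simp
qed

text \<open>An explicit majorant of \<open>\<sigma>(m) + 1\<close>, since the divisor sum is at most
  \<open>m * (1 + ln m)\<close>. Its logarithm is asymptotic to \<open>ln m\<close>, so sieving this
  far preserves the constant in Mertens' product.\<close>

definition sieve_bound :: "nat \<Rightarrow> real" where
  "sieve_bound m = real m * (2 + ln (real m))"

lemma sieve_bound_large:
  assumes "m \<ge> 1" "r > 0" "\<forall>p\<in>primes_upto (sieve_bound m). \<not> p dvd r" "prime p" "p dvd r"
  shows "\<Sum>{d. d dvd m} + 1 < p"
proof -
  have "real (\<Sum>{d. d dvd m} + 1) \<le> sieve_bound m"
    using sum_divisors_le[OF assms(1)] assms(1) by (simp add: sieve_bound_def algebra_simps)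
  also have "\<dots> < real p" using assms by (auto simp: primes_upto_def)
  finally show ?thesis by (simp only: of_nat_less_iff)
qed

text \<open>The cut-off \<open>X\<close> keeps the family finite, so that a single period
  \<open>Q\<close> serves all its members; it is sent to infinity later.\<close>

lemma divisor_sum_density_ge_practical:
  assumes "t \<ge> 1"
  shows "(\<Sum>m | practical m \<and> t \<le> m \<and> m < X. exp (- mertens_log (sieve_bound m)) / real m)
           \<le> divisor_sum_density t"
proof -
  define I where "I = {m. practical m \<and> t \<le> m \<and> m < X}"
  define Q where "Q = fact t * (\<Prod>m\<in>I. m * \<Prod>(primes_upto (sieve_bound m)))"
  define E where "E = (\<lambda>m n. m dvd n \<and> (\<forall>p\<in>primes_upto (sieve_bound m). \<not> p dvd n div m))"
  have fin: "finite I" unfolding I_def by simp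
  have I: "m \<ge> 1" "practical m" "t \<le> m" if "m \<in> I" for m
    using that assms by (auto simp: I_def)
  have "Q > 0" unfolding Q_def
    by (force intro!: prod_pos dest: I(1) simp: primes_upto_def prime_gt_0_nat)
  have "(\<Sum>m\<in>I. exp (- mertens_log (sieve_bound m)) / real m) = (\<Sum>m\<in>I. freq Q (E m))"
  proof (intro sum.cong refl)
    fix m assume m: "m \<in> I"
    have "m * \<Prod>(primes_upto (sieve_bound m)) dvd (\<Prod>m\<in>I. m * \<Prod>(primes_upto (sieve_bound m)))"
      using fin m by (rule dvd_prodI)
    then have "m * \<Prod>(primes_upto (sieve_bound m)) dvd Q" by (simp add: Q_def)
    from freq_practical_part[OF I(1)[OF m] this \<open>Q > 0\<close>]
    show "exp (- mertens_log (sieve_bound m)) / real m = freq Q (E m)"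
      unfolding E_def by simp
  qed
  also have "\<dots> = freq Q (\<lambda>n. \<exists>m\<in>I. E m n)"
  proof (rule freq_bex_disjoint [symmetric])
    \<comment> \<open>Both candidates are practical, and the cofactor of either has only large
      primes, so \<open>practical_dvd_practical_part\<close> applies in both directions.\<close>
    have *: "i dvd j" if n: "n \<ge> 1" "i \<in> I" "j \<in> I" "E i n" "E j n" for n i j
    proof -
      have "j dvd n" "i dvd n" using n by (simp_all add: E_def)
      then have r: "n = j * (n div j)" "n div j > 0"
        using n(1) by (simp, intro Nat.gr0I) (auto simp: dvd_div_eq_0_iff)
      show ?thesis
      proof (rule practical_dvd_practical_part[where r = "n div j"])
        show "practical i" "j > 0" using I(2)[of i] I(1)[of j] n by auto
        show "i dvd j * (n div j)" using \<open>i dvd n\<close> r(1) by simp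
        show "\<Sum>{d. d dvd j} + 1 < p" if "prime p" "p dvd n div j" for p
        proof (rule sieve_bound_large)
          show "\<forall>p\<in>primes_upto (sieve_bound j). \<not> p dvd n div j"
            by (rule conjunct2[OF n(5)[unfolded E_def]])
          show "j \<ge> 1" using I(1)[OF n(3)] .
        qed (use r that in auto)
      qed (use r in simp)
    qed
    show "i = j" if "n \<ge> 1" "i \<in> I" "j \<in> I" "E i n" "E j n" for n i j
      using *[OF that] *[OF that(1,3,2,5,4)] by (rule dvd_antisym)
  qed (rule fin)
  also have "\<dots> \<le> freq Q (sum_of_distinct_divisors t)"
  proof (rule freq_mono)
    fix n assume "\<exists>m\<in>I. E m n"
    then obtain m where m: "m \<in> I" "m dvd n" by (auto simp: E_def)
    have "sum_of_distinct_divisors t m" using I[OF m(1)] assms by (auto simp: practical_def)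
    then obtain S where S: "S \<subseteq> {d. d dvd m}" "\<Sum>S = t"
      unfolding sum_of_distinct_divisors_def by blast
    have "S \<subseteq> {d. d dvd n}" using S(1) m(2) dvd_trans by blast
    then show "sum_of_distinct_divisors t n"
      using S(2) unfolding sum_of_distinct_divisors_def by blast
  qed
  also have "\<dots> = divisor_sum_density t"
    by (rule divisor_sum_density_eq_freq [symmetric]) (use \<open>Q > 0\<close> in \<open>auto simp: Q_def\<close>)
  finally show ?thesis by (simp add: I_def)
qed

text \<open>The limit is known only along \<open>exp (real N)\<close>. Rounding the logarithm of the
  sieve bound up to an integer \<open>N m\<close> can only shrink the product, and
  \<open>ln m / N m\<close> tends to 1.\<close>

lemma exp_mertens_log_sieve_bound_ge:
  assumes "\<kappa> < exp (- euler_mascheroni)"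
  shows "eventually (\<lambda>m. \<kappa> / ln (real m) \<le> exp (- mertens_log (sieve_bound m))) at_top"
proof -
  obtain L where L: "(\<lambda>N. mertens_log (exp (real N)) - ln (real N)) \<longlonglongrightarrow> L" "L \<le> euler_mascheroni"
    by (rule mertens_log_minus_ln_convergent)
  define N where "N = (\<lambda>m. nat \<lceil>ln (real m * (2 + ln (real m)))\<rceil>)"
  have N1: "(\<lambda>m. ln (real m) / real (N m)) \<longlonglongrightarrow> 1" unfolding N_def by real_asymp
  have N2: "filterlim N at_top at_top" unfolding N_def by real_asymp
  have "(\<lambda>m. exp (- (mertens_log (exp (real (N m))) - ln (real (N m)))) * (ln (real m) / real (N m)))
      \<longlonglongrightarrow> exp (- L) * 1"
    by (intro tendsto_intros N1 filterlim_compose[OF L(1) N2])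
  moreover have "\<kappa> < exp (- L) * 1" using assms L(2) by (smt (verit) exp_le_cancel_iff mult_1_right)
  ultimately have "eventually (\<lambda>m. \<kappa> < exp (- (mertens_log (exp (real (N m))) - ln (real (N m)))) * (ln (real m) / real (N m))) at_top"
    by (rule order_tendstoD)
  moreover have "eventually (\<lambda>m. N m \<ge> 1) at_top" using N2 by (simp add: filterlim_at_top)
  ultimately show ?thesis using eventually_ge_at_top[of 2]
  proof eventually_elim
    case (elim m)
    have m: "ln (real m) > 0" using elim by simp
    have s: "sieve_bound m > 0" using elim m by (simp add: sieve_bound_def add_pos_pos)
    have "ln (sieve_bound m) \<le> real (N m)" unfolding N_def sieve_bound_def by linarith
    then have "sieve_bound m \<le> exp (real (N m))" using s by (metis exp_le_cancel_iff exp_ln)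
    then have "exp (- mertens_log (exp (real (N m)))) \<le> exp (- mertens_log (sieve_bound m))"
      by (simp add: mertens_log_mono)
    then have "exp (- mertens_log (exp (real (N m)))) * ln (real m) \<le> exp (- mertens_log (sieve_bound m)) * ln (real m)"
      by (rule mult_right_mono) (use m in simp)
    moreover have "exp (- (A - ln (real (N m)))) * (l / real (N m)) = exp (- A) * l" for A l :: real
    proof -
      have "exp (- (A - ln (real (N m)))) = exp (- A + ln (real (N m)))" by simp
      also have "\<dots> = exp (- A) * real (N m)" unfolding exp_add using elim by simp
      finally show ?thesis using elim by simp
    qed
    then have "\<kappa> < exp (- mertens_log (exp (real (N m)))) * ln (real m)"
      using elim(1) by simp
    ultimately have "\<kappa> \<le> exp (- mertens_log (sieve_bound m)) * ln (real m)" by linarith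
    then show ?case using m by (simp only: pos_divide_le_eq)
  qed
qed

section \<open>Summation by parts over the practical numbers\<close>

lemma sum_by_parts_counting:
  fixes f g :: "nat \<Rightarrow> real"
  assumes "t \<le> Y"
  shows "(\<Sum>n\<in>{t..<Y}. f n * g n) =
    (\<Sum>k<Y. f k) * g Y - (\<Sum>k<t. f k) * g t + (\<Sum>n\<in>{t..<Y}. (\<Sum>k\<le>n. f k) * (g n - g (Suc n)))"
  using assms
proof (induction rule: dec_induct)
  case (step n)
  have "(\<Sum>k\<le>n. f k) = (\<Sum>k<n. f k) + f n" by (simp add: lessThan_Suc flip: lessThan_Suc_atMost)
  then show ?case using step by (simp add: algebra_simps)
qed simp

lemma practical_constant_limit:
  assumes "is_practical_constant c"
  shows "c > 0"
    and "(\<lambda>n. real (card {m. practical m \<and> m \<le> n}) * ln (real n) / real n) \<longlonglongrightarrow> c"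
proof -
  let ?P = "\<lambda>x::real. real (card {m. practical m \<and> real m \<le> x})"
  have ae: "?P \<sim>[at_top] (\<lambda>x. c * x / ln x)"
    using assms by (simp add: is_practical_constant_def)
  have "sum_of_distinct_divisors 1 1"
    unfolding sum_of_distinct_divisors_def by (rule exI[of _ "{1}"]) simp
  then have "practical 1" by (simp add: practical_def)
  have P: "?P x > 0" if "x \<ge> 1" for x
  proof -
    have "finite {m. practical m \<and> real m \<le> x}"
      by (rule finite_subset[of _ "{..nat \<lfloor>x\<rfloor>}"]) (auto simp: le_nat_floor)
    moreover have "1 \<in> {m. practical m \<and> real m \<le> x}" using \<open>practical 1\<close> that by simp
    ultimately show ?thesis by (auto simp: card_gt_0_iff)
  qed
  have "eventually (\<lambda>x::real. c > 0) at_top"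
    using asymp_equiv_imp_eventually_same_sign[OF ae] eventually_gt_at_top[of 1]
  proof eventually_elim
    case (elim x)
    have "sgn (?P x) = 1" using P[of x] elim by (intro sgn_pos) simp
    then have "sgn (c * x / ln x) = 1" using elim(1) by (rule trans[OF sym, rotated])
    then have "c * x / ln x > 0" by (simp only: sgn_1_pos)
    then show ?case using elim by (simp add: zero_less_divide_iff zero_less_mult_iff)
  qed
  then show "c > 0" by simp
  have "((\<lambda>x. ?P x / (c * x / ln x)) \<longlongrightarrow> 1) at_top"
  proof (rule asymp_equivD_strong[OF ae])
    show "\<forall>\<^sub>F x in at_top. ?P x \<noteq> 0 \<or> c * x / ln x \<noteq> 0"
      using eventually_ge_at_top[of 1]
    proof eventually_elim
      case (elim x)
      then show ?case using P[of x] by (intro disjI1) simp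
    qed
  qed
  then have "((\<lambda>n. ?P (real n) / (c * real n / ln (real n))) \<longlongrightarrow> 1) sequentially"
    by (rule filterlim_compose[OF _ filterlim_real_sequentially])
  then have "((\<lambda>n. c * (?P (real n) / (c * real n / ln (real n)))) \<longlongrightarrow> c * 1) sequentially"
    by (intro tendsto_intros)
  then show "(\<lambda>n. real (card {m. practical m \<and> m \<le> n}) * ln (real n) / real n) \<longlonglongrightarrow> c"
    using \<open>c > 0\<close> by (simp add: mult.assoc)
qed

text \<open>A mean value bound for \<open>1 / ln\<close>; read backwards, it replaces
  \<open>1 / (n * (ln n)\<^sup>2)\<close> by a telescoping difference.\<close>

lemma inverse_ln_diff_le:
  assumes "n \<ge> 2"
  shows "1 / ln (real n) - 1 / ln (real (Suc n)) \<le> 1 / (real n * (ln (real n))\<^sup>2)"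
proof -
  have l: "ln (real n) > 0" "ln (real n) \<le> ln (real (Suc n))" "n > 0" using assms by auto
  have "ln (real (Suc n)) - ln (real n) = ln (1 + 1 / real n)"
    using assms ln_div[of "real (Suc n)" "real n"] by (simp add: add_divide_distrib add.commute)
  also have "\<dots> \<le> 1 / real n" by (rule ln_add_one_self_le_self) simp
  finally have d: "ln (real (Suc n)) - ln (real n) \<le> 1 / real n" .
  have "1 / ln (real n) - 1 / ln (real (Suc n)) = (ln (real (Suc n)) - ln (real n)) / (ln (real n) * ln (real (Suc n)))"
    using l by (subst diff_frac_eq) (auto simp del: of_nat_Suc)
  also have "\<dots> \<le> (1 / real n) / (ln (real n) * ln (real n))"
    by (rule frac_le) (use l d in \<open>auto intro!: mult_left_mono mult_pos_pos simp del: of_nat_Suc ln_gt_zero_iff\<close>)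
  finally show ?thesis by (simp add: power2_eq_square)
qed

text \<open>Summation by parts with \<open>g m = 1 / (m * ln m)\<close>. The boundary term at
  \<open>Y\<close> is nonnegative and dropped; the one at \<open>t\<close> costs
  \<open>c2 / (ln t)\<^sup>2\<close>. Inside, \<open>n / ln n * (g n - g (Suc n))\<close> is at
  least \<open>n / (n + 1)\<close> times a telescoping difference of \<open>1 / ln\<close>, and
  \<open>n / (n + 1) >= t / (t + 1)\<close>.\<close>

lemma sum_practical_ge:
  assumes t: "t \<ge> 2" "t \<le> Y" and c1: "c1 \<ge> 0"
    and lower: "\<And>n. n \<ge> t \<Longrightarrow> c1 * real n / ln (real n) \<le> real (card {m. practical m \<and> m \<le> n})"
    and upper: "real (card {m. practical m \<and> m \<le> t}) \<le> c2 * real t / ln (real t)"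
  shows "c1 * (real t / (real t + 1)) * (1 / ln (real t) - 1 / ln (real Y)) - c2 / (ln (real t))\<^sup>2 \<le>
      (\<Sum>m | practical m \<and> t \<le> m \<and> m < Y. 1 / (real m * ln (real m)))"
proof -
  define f where "f = (\<lambda>m. of_bool (practical m) :: real)"
  define g where "g = (\<lambda>m. 1 / (real m * ln (real m)))"
  have P: "(\<Sum>k\<le>n. f k) = real (card {m. practical m \<and> m \<le> n})" for n
  proof -
    have "{..n} \<inter> Collect practical = {m. practical m \<and> m \<le> n}" by auto
    then show ?thesis by (simp add: f_def)
  qed
  have lt: "ln (real t) > 0" using t by simp
  have "(\<Sum>m | practical m \<and> t \<le> m \<and> m < Y. g m) = (\<Sum>m\<in>{t..<Y}. f m * g m)"
  proof -
    have "(\<Sum>m\<in>{t..<Y}. f m * g m) = (\<Sum>m\<in>{t..<Y}. if practical m then g m else 0)"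
      by (intro sum.cong) (auto simp: f_def)
    also have "\<dots> = (\<Sum>m\<in>{m \<in> {t..<Y}. practical m}. g m)"
      by (rule sum.inter_filter [symmetric]) simp
    also have "{m \<in> {t..<Y}. practical m} = {m. practical m \<and> t \<le> m \<and> m < Y}" by auto
    finally show ?thesis by simp
  qed
  also have "\<dots> = (\<Sum>k<Y. f k) * g Y - (\<Sum>k<t. f k) * g t +
      (\<Sum>n\<in>{t..<Y}. (\<Sum>k\<le>n. f k) * (g n - g (Suc n)))"
    by (rule sum_by_parts_counting) (rule t)
  finally have eq: "(\<Sum>m | practical m \<and> t \<le> m \<and> m < Y. g m) = \<dots>" .
  have "0 \<le> (\<Sum>k<Y. f k) * g Y" using t by (auto simp: f_def g_def)
  moreover have "(\<Sum>k<t. f k) * g t \<le> c2 / (ln (real t))\<^sup>2"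
  proof -
    have "(\<Sum>k<t. f k) \<le> (\<Sum>k\<le>t. f k)" by (rule sum_mono2) (auto simp: f_def)
    also have "\<dots> \<le> c2 * real t / ln (real t)" using upper by (simp add: P)
    finally have "(\<Sum>k<t. f k) * g t \<le> c2 * real t / ln (real t) * g t"
      by (rule mult_right_mono) (use t in \<open>simp add: g_def\<close>)
    also have "\<dots> = c2 / (ln (real t))\<^sup>2" using t by (simp add: g_def power2_eq_square)
    finally show ?thesis .
  qed
  moreover have "c1 * (real t / (real t + 1)) * (1 / ln (real t) - 1 / ln (real Y)) \<le>
      (\<Sum>n\<in>{t..<Y}. (\<Sum>k\<le>n. f k) * (g n - g (Suc n)))"
  proof -
    have "c1 * (real t / (real t + 1)) * (1 / ln (real n) - 1 / ln (real (Suc n))) \<le>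
        (\<Sum>k\<le>n. f k) * (g n - g (Suc n))" if n: "n \<in> {t..<Y}" for n
    proof -
      have n2: "n \<ge> 2" "n \<ge> t" using n t by auto
      then have ln: "ln (real n) > 0" by simp
      have "real t / (real t + 1) \<le> real n / (real n + 1)"
        using n2 by (simp add: field_simps)
      have "c1 * (real t / (real t + 1)) * (1 / ln (real n) - 1 / ln (real (Suc n))) \<le>
          c1 * (real n / (real n + 1)) * (1 / (real n * (ln (real n))\<^sup>2))"
        using n2 c1 ln \<open>real t / (real t + 1) \<le> _\<close>
        by (intro mult_mono inverse_ln_diff_le) (auto simp: frac_le)
      also have "\<dots> = c1 * real n / ln (real n) * (1 / (real n * (real n + 1) * ln (real n)))"
        using n2 by (simp add: power2_eq_square mult_ac)
      also have "\<dots> \<le> c1 * real n / ln (real n) * (g n - g (Suc n))"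
      proof (rule mult_left_mono)
        \<comment> \<open>Replacing \<open>ln (Suc n)\<close> by \<open>ln n\<close> enlarges
          \<open>g (Suc n)\<close> and leaves an exact difference of reciprocals.\<close>
        have "g (Suc n) \<le> 1 / (real (Suc n) * ln (real n))"
          unfolding g_def using ln n2 by (intro divide_left_mono mult_left_mono mult_pos_pos) auto
        moreover have "1 / (real n * (real n + 1) * ln (real n)) = g n - 1 / (real (Suc n) * ln (real n))"
        proof -
          have "1 / (a * (a + 1) * l) = 1 / (a * l) - 1 / ((a + 1) * l)" if "a > 0" "l > 0" for a l :: real
            using that by (simp add: divide_simps)
          from this[of "real n" "ln (real n)"] show ?thesis using ln n2 by (simp add: g_def add.commute)
        qed
        ultimately show "1 / (real n * (real n + 1) * ln (real n)) \<le> g n - g (Suc n)" by simp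
        then have "0 \<le> g n - g (Suc n)" using ln by (intro order.trans[of 0 _ "g n - g (Suc n)"]) auto
      qed (use c1 ln in auto)
      also have "\<dots> \<le> (\<Sum>k\<le>n. f k) * (g n - g (Suc n))"
      proof (rule mult_right_mono)
        show "c1 * real n / ln (real n) \<le> (\<Sum>k\<le>n. f k)" using lower[of n] n2 by (simp add: P)
        have "g (Suc n) \<le> g n"
          unfolding g_def using ln n2 by (intro divide_left_mono mult_mono mult_pos_pos) auto
        then show "0 \<le> g n - g (Suc n)" by simp
      qed
      finally show ?thesis .
    qed
    then have "(\<Sum>n\<in>{t..<Y}. c1 * (real t / (real t + 1)) * (1 / ln (real n) - 1 / ln (real (Suc n)))) \<le>
        (\<Sum>n\<in>{t..<Y}. (\<Sum>k\<le>n. f k) * (g n - g (Suc n)))"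
      by (rule sum_mono)
    moreover have "(\<Sum>n\<in>{t..<Y}. 1 / ln (real n) - 1 / ln (real (Suc n))) = 1 / ln (real t) - 1 / ln (real Y)"
      using sum_Suc_diff'[OF t(2), of "\<lambda>n. - (1 / ln (real n))"] by simp
    ultimately show ?thesis by (simp only: sum_distrib_left [symmetric])
  qed
  ultimately show ?thesis unfolding eq[unfolded g_def] by (simp add: g_def)
qed

text \<open>The slack in \<open>\<mu>\<close> is shared by the practical count and Mertens' product,
  as \<open>c1\<close> and \<open>\<kappa>\<close>. For fixed \<open>t\<close> the cut-off goes to
  infinity, which removes \<open>1 / ln Y\<close>; then \<open>t\<close> grows, which removes
  \<open>t / (t + 1)\<close> and the boundary term.\<close>

lemma divisor_sum_density_lower:
  assumes c: "is_practical_constant c" and \<mu>: "\<mu> < c * exp (- euler_mascheroni)"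
  shows "eventually (\<lambda>t. \<mu> \<le> divisor_sum_density t * ln (real t)) at_top"
proof -
  note c0 = practical_constant_limit(1)[OF c] and clim = practical_constant_limit(2)[OF c]
  have "((\<lambda>e::real. (c - e) * (exp (- euler_mascheroni) - e)) \<longlongrightarrow> (c - 0) * (exp (- euler_mascheroni) - 0)) (at_right 0)"
    by (intro tendsto_intros)
  then have "eventually (\<lambda>e::real. \<mu> < (c - e) * (exp (- euler_mascheroni) - e)) (at_right 0)"
    by (rule order_tendstoD) (use \<mu> in simp)
  moreover have "eventually (\<lambda>e::real. 0 < e \<and> e < min c (exp (- euler_mascheroni))) (at_right 0)"
    by (rule eventually_at_rightI[of 0 "min c (exp (- euler_mascheroni))"]) (use c0 in auto)
  ultimately have "eventually (\<lambda>e::real. \<mu> < (c - e) * (exp (- euler_mascheroni) - e) \<and> 0 < e \<and> e < min c (exp (- euler_mascheroni))) (at_right 0)"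
    by eventually_elim auto
  then obtain e where e: "\<mu> < (c - e) * (exp (- euler_mascheroni) - e)" "0 < e" "e < c" "e < exp (- euler_mascheroni)"
    by (auto dest!: eventually_happens simp: trivial_limit_at_right_real)
  define c1 where "c1 = c - e"
  define c2 where "c2 = c + e"
  define \<kappa> where "\<kappa> = exp (- euler_mascheroni) - e"
  have pos: "c1 > 0" "\<kappa> > 0" "\<kappa> < exp (- euler_mascheroni)" "\<mu> < c1 * \<kappa>"
    using e by (auto simp: c1_def \<kappa>_def)
  have "eventually (\<lambda>n. c1 < real (card {m. practical m \<and> m \<le> n}) * ln (real n) / real n \<and>
      real (card {m. practical m \<and> m \<le> n}) * ln (real n) / real n < c2) at_top"
    using order_tendstoD[OF clim, of c1] order_tendstoD[OF clim, of c2] e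
    by (intro eventually_conj) (auto simp: c1_def c2_def)
  moreover have "eventually (\<lambda>m. \<kappa> / ln (real m) \<le> exp (- mertens_log (sieve_bound m))) at_top"
    by (rule exp_mertens_log_sieve_bound_ge) (use pos in simp)
  ultimately have "eventually (\<lambda>n. c1 < real (card {m. practical m \<and> m \<le> n}) * ln (real n) / real n \<and>
      real (card {m. practical m \<and> m \<le> n}) * ln (real n) / real n < c2 \<and>
      \<kappa> / ln (real n) \<le> exp (- mertens_log (sieve_bound n))) at_top"
    by eventually_elim auto
  then obtain N where N: "\<And>n. n \<ge> N \<Longrightarrow> c1 < real (card {m. practical m \<and> m \<le> n}) * ln (real n) / real n"
    "\<And>n. n \<ge> N \<Longrightarrow> real (card {m. practical m \<and> m \<le> n}) * ln (real n) / real n < c2"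
    "\<And>n. n \<ge> N \<Longrightarrow> \<kappa> / ln (real n) \<le> exp (- mertens_log (sieve_bound n))"
    by (auto simp: eventually_at_top_linorder)
  have main: "\<kappa> * (c1 * (real t / (real t + 1)) - c2 / ln (real t)) \<le> divisor_sum_density t * ln (real t)"
    if t: "t \<ge> N" "t \<ge> 2" for t
  proof -
    have lt: "ln (real t) > 0" using t by simp
    have "\<kappa> * (c1 * (real t / (real t + 1)) * (1 / ln (real t) - 1 / ln (real Y)) - c2 / (ln (real t))\<^sup>2)
        \<le> divisor_sum_density t" if Y: "Y \<ge> t" for Y
    proof -
      have "c1 * (real t / (real t + 1)) * (1 / ln (real t) - 1 / ln (real Y)) - c2 / (ln (real t))\<^sup>2 \<le>
          (\<Sum>m | practical m \<and> t \<le> m \<and> m < Y. 1 / (real m * ln (real m)))"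
      proof (rule sum_practical_ge)
        show "c1 * real n / ln (real n) \<le> real (card {m. practical m \<and> m \<le> n})" if "n \<ge> t" for n
          using N(1)[of n] that t by (simp add: field_simps)
        show "real (card {m. practical m \<and> m \<le> t}) \<le> c2 * real t / ln (real t)"
          using N(2)[of t] t by (simp add: field_simps)
      qed (use t Y pos in auto)
      then have "\<kappa> * (c1 * (real t / (real t + 1)) * (1 / ln (real t) - 1 / ln (real Y)) - c2 / (ln (real t))\<^sup>2) \<le>
          \<kappa> * (\<Sum>m | practical m \<and> t \<le> m \<and> m < Y. 1 / (real m * ln (real m)))"
        by (rule mult_left_mono) (use pos in simp)
      also have "\<dots> = (\<Sum>m | practical m \<and> t \<le> m \<and> m < Y. \<kappa> / ln (real m) / real m)"
        by (simp add: sum_distrib_left mult.commute)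
      also have "\<dots> \<le> (\<Sum>m | practical m \<and> t \<le> m \<and> m < Y. exp (- mertens_log (sieve_bound m)) / real m)"
        by (intro sum_mono divide_right_mono N(3)) (use t in auto)
      also have "\<dots> \<le> divisor_sum_density t"
        by (rule divisor_sum_density_ge_practical) (use t in simp)
      finally show ?thesis .
    qed
    moreover have "(\<lambda>Y. \<kappa> * (c1 * (real t / (real t + 1)) * (1 / ln (real t) - 1 / ln (real Y)) - c2 / (ln (real t))\<^sup>2))
        \<longlonglongrightarrow> \<kappa> * (c1 * (real t / (real t + 1)) * (1 / ln (real t) - 0) - c2 / (ln (real t))\<^sup>2)"
    proof (intro tendsto_intros)
      show "(\<lambda>Y. 1 / ln (real Y)) \<longlonglongrightarrow> 0" by real_asymp
    qed
    ultimately have "\<kappa> * (c1 * (real t / (real t + 1)) * (1 / ln (real t) - 0) - c2 / (ln (real t))\<^sup>2) \<le> divisor_sum_density t"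
      by (intro LIMSEQ_le_const2) auto
    then have "\<kappa> * (c1 * (real t / (real t + 1)) * (1 / ln (real t) - 0) - c2 / (ln (real t))\<^sup>2) * ln (real t) \<le> divisor_sum_density t * ln (real t)"
      by (rule mult_right_mono) (use lt in simp)
    moreover have eq: "\<kappa> * (A * (1 / l - 0) - c2 / l\<^sup>2) * l = \<kappa> * (A - c2 / l)" if "l > 0" for A l :: real
      using that by (simp add: field_simps power2_eq_square)
    ultimately show ?thesis unfolding eq[OF lt] by simp
  qed
  have "(\<lambda>t. \<kappa> * (c1 * (real t / (real t + 1)) - c2 / ln (real t))) \<longlonglongrightarrow> \<kappa> * (c1 * 1 - 0)"
  proof (intro tendsto_intros)
    show "(\<lambda>t. real t / (real t + 1)) \<longlonglongrightarrow> 1" by real_asymp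
    show "(\<lambda>t. c2 / ln (real t)) \<longlonglongrightarrow> 0" by real_asymp
  qed
  then have "eventually (\<lambda>t. \<mu> < \<kappa> * (c1 * (real t / (real t + 1)) - c2 / ln (real t))) at_top"
    by (rule order_tendstoD) (use pos in \<open>simp add: mult.commute\<close>)
  then show ?thesis using eventually_ge_at_top[of N] eventually_ge_at_top[of 2]
    by eventually_elim (use main in fastforce)
qed

section \<open>The number of divisors up to \<open>T\<close>\<close>

text \<open>The elementary symmetric polynomial of degree \<open>k\<close> in the values
  \<open>a p\<close>.\<close>

definition esymm :: "('a \<Rightarrow> real) \<Rightarrow> 'a set \<Rightarrow> nat \<Rightarrow> real" where
  "esymm a X k = (\<Sum>D | D \<subseteq> X \<and> card D = k. \<Prod>p\<in>D. a p)"

lemma esymm_0: "finite X \<Longrightarrow> esymm a X 0 = 1"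
proof -
  assume "finite X"
  then have "{D. D \<subseteq> X \<and> card D = 0} = {{}}" by (auto dest: finite_subset)
  then show ?thesis by (simp add: esymm_def)
qed

lemma esymm_insert:
  assumes "finite X" "q \<notin> X"
  shows "esymm a (insert q X) (Suc k) = esymm a X (Suc k) + a q * esymm a X k"
proof -
  let ?A = "\<lambda>k. {D. D \<subseteq> X \<and> card D = k}"
  have fin: "finite (?A k)" for k using assms by simp
  have "{D. D \<subseteq> insert q X \<and> card D = Suc k} = ?A (Suc k) \<union> insert q ` ?A k"
  proof (intro equalityI subsetI)
    fix D assume D: "D \<in> {D. D \<subseteq> insert q X \<and> card D = Suc k}"
    then have fD: "finite D" using assms(1) by (auto intro: finite_subset)
    show "D \<in> ?A (Suc k) \<union> insert q ` ?A k"
    proof (cases "q \<in> D")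
      case True
      then have "D - {q} \<in> ?A k" "D = insert q (D - {q})" using D fD by auto
      then show ?thesis by blast
    qed (use D in auto)
  next
    fix D assume "D \<in> ?A (Suc k) \<union> insert q ` ?A k"
    then show "D \<in> {D. D \<subseteq> insert q X \<and> card D = Suc k}"
    proof
      assume "D \<in> insert q ` ?A k"
      then obtain D' where D': "D = insert q D'" "D' \<subseteq> X" "card D' = k" by auto
      moreover have "finite D'" using D' assms(1) finite_subset by blast
      moreover have "q \<notin> D'" using D'(2) assms(2) by blast
      ultimately show ?thesis by auto
    qed auto
  qed
  then have "esymm a (insert q X) (Suc k) = (\<Sum>D\<in>?A (Suc k) \<union> insert q ` ?A k. \<Prod>p\<in>D. a p)"
    by (simp add: esymm_def)
  also have "\<dots> = esymm a X (Suc k) + (\<Sum>D\<in>insert q ` ?A k. \<Prod>p\<in>D. a p)"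
    unfolding esymm_def by (rule sum.union_disjoint) (use fin assms in auto)
  also have "(\<Sum>D\<in>insert q ` ?A k. \<Prod>p\<in>D. a p) = (\<Sum>D\<in>?A k. \<Prod>p\<in>insert q D. a p)"
    by (rule sum.reindex_cong[of "insert q"]) (use assms in \<open>auto simp: inj_on_def\<close>)
  also have "\<dots> = (\<Sum>D\<in>?A k. a q * (\<Prod>p\<in>D. a p))"
  proof (rule sum.cong)
    fix D assume "D \<in> ?A k"
    then have "finite D" "q \<notin> D" using assms by (auto intro: finite_subset)
    then show "(\<Prod>p\<in>insert q D. a p) = a q * (\<Prod>p\<in>D. a p)" by simp
  qed simp
  also have "\<dots> = a q * esymm a X k" by (simp add: esymm_def sum_distrib_left)
  finally show ?thesis .
qed

lemma power_add_ge:
  fixes s a :: real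
  assumes "s \<ge> 0" "a \<ge> 0"
  shows "s ^ Suc k + real (Suc k) * a * s ^ k \<le> (s + a) ^ Suc k"
proof (induction k)
  case (Suc k)
  have "s ^ Suc (Suc k) + real (Suc (Suc k)) * a * s ^ Suc k \<le>
      (s + a) * (s ^ Suc k + real (Suc k) * a * s ^ k)"
    using assms by (simp add: algebra_simps)
  also have "\<dots> \<le> (s + a) * (s + a) ^ Suc k" using Suc assms by (intro mult_left_mono) auto
  finally show ?case by simp
qed simp

text \<open>Every squarefree monomial occurs \<open>fact k\<close> times in the expanded power. In
  the induction, the new element accounts for the first two terms of a binomial expansion, which
  \<open>power_add_ge\<close> bounds.\<close>

lemma esymm_le:
  assumes "finite X" "\<And>p. p \<in> X \<Longrightarrow> a p \<ge> 0"
  shows "fact k * esymm a X k \<le> (\<Sum>p\<in>X. a p) ^ k"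
  using assms
proof (induction X arbitrary: k)
  case empty
  show ?case
  proof (cases k)
    case (Suc j)
    have "\<not> (D \<subseteq> {} \<and> card D = Suc j)" for D :: "'a set" by auto
    then show ?thesis by (simp only: esymm_def Suc Collect_empty_eq) simp
  qed (simp add: esymm_0)
next
  case (insert q X)
  show ?case
  proof (cases k)
    case 0
    then show ?thesis using insert by (simp add: esymm_0)
  next
    case (Suc j)
    let ?s = "\<Sum>p\<in>X. a p"
    have s: "?s \<ge> 0" using insert by (intro sum_nonneg) auto
    have "fact k * esymm a (insert q X) k = fact (Suc j) * esymm a X (Suc j) + real (Suc j) * a q * (fact j * esymm a X j)"
      using insert Suc by (simp add: esymm_insert algebra_simps)
    also have "\<dots> \<le> ?s ^ Suc j + real (Suc j) * a q * ?s ^ j"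
    proof (intro add_mono mult_left_mono)
      show "fact i * esymm a X i \<le> ?s ^ i" for i using insert by auto
    qed (use insert in auto)
    also have "\<dots> \<le> (?s + a q) ^ Suc j" by (rule power_add_ge) (use s insert in auto)
    finally show ?thesis using insert Suc by (simp add: add.commute)
  qed
qed

section \<open>Poisson bounds for the number of prime divisors\<close>

definition omega_upto :: "real \<Rightarrow> nat \<Rightarrow> nat" where
  "omega_upto x n = card {p \<in> primes_upto x. p dvd n}"

text \<open>Split by the exact set \<open>D\<close> of primes dividing \<open>n\<close>. Writing
  \<open>1 / p\<close> as \<open>(1 - 1 / p) * (1 / (p - 1))\<close> for \<open>p\<close> in
  \<open>D\<close> completes the full Mertens product; what is left is an elementary symmetric
  polynomial, and \<open>esymm_le\<close> turns it into a Poisson weight.\<close>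

lemma freq_omega_eq_le:
  assumes "\<Prod>(primes_upto x) dvd Q" "Q > 0"
  shows "freq Q (\<lambda>n. omega_upto x n = k) \<le>
           exp (- mertens_log x) * (\<Sum>p\<in>primes_upto x. 1 / (real p - 1)) ^ k / fact k"
proof -
  let ?X = "primes_upto x"
  let ?I = "{D. D \<subseteq> ?X \<and> card D = k}"
  let ?E = "\<lambda>D n. (\<forall>p\<in>D. p dvd n) \<and> (\<forall>p\<in>?X - D. \<not> p dvd n)"
  have "freq Q (\<lambda>n. omega_upto x n = k) \<le> freq Q (\<lambda>n. \<exists>D\<in>?I. ?E D n)"
  proof (rule freq_mono)
    fix n assume "omega_upto x n = k"
    then show "\<exists>D\<in>?I. ?E D n"
      by (intro bexI[of _ "{p \<in> ?X. p dvd n}"]) (auto simp: omega_upto_def)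
  qed
  also have "\<dots> \<le> (\<Sum>D\<in>?I. freq Q (?E D))" by (rule freq_bex_le) simp
  also have "\<dots> = (\<Sum>D\<in>?I. exp (- mertens_log x) * (\<Prod>p\<in>D. 1 / (real p - 1)))"
  proof (rule sum.cong)
    fix D assume D: "D \<in> ?I"
    have un: "D \<union> (?X - D) = ?X" using D by auto
    have fD: "finite D" using D finite_subset by auto
    have "freq Q (?E D) = (\<Prod>p\<in>D. 1 / real p) * (\<Prod>p\<in>?X - D. 1 - 1 / real p)"
    proof (rule freq_sieve)
      show "\<Prod>(D \<union> (?X - D)) dvd Q" unfolding un by (rule assms)
      show "prime p" if "p \<in> D \<union> (?X - D)" for p using that unfolding un by (simp add: primes_upto_def)
    qed (use assms fD in auto)
    also have "(\<Prod>p\<in>D. 1 / real p) = (\<Prod>p\<in>D. (1 - 1 / real p) * (1 / (real p - 1)))"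
    proof (rule prod.cong)
      fix p assume "p \<in> D"
      then have "real p \<ge> 2" using D prime_upto_ge_2 by auto
      then show "1 / real p = (1 - 1 / real p) * (1 / (real p - 1))" by (simp add: field_simps)
    qed simp
    also have "\<dots> = (\<Prod>p\<in>D. 1 - 1 / real p) * (\<Prod>p\<in>D. 1 / (real p - 1))" by (rule prod.distrib)
    also have "\<dots> * (\<Prod>p\<in>?X - D. 1 - 1 / real p) =
        ((\<Prod>p\<in>D. 1 - 1 / real p) * (\<Prod>p\<in>?X - D. 1 - 1 / real p)) * (\<Prod>p\<in>D. 1 / (real p - 1))"
      by (simp only: mult_ac)
    also have "(\<Prod>p\<in>D. 1 - 1 / real p) * (\<Prod>p\<in>?X - D. 1 - 1 / real p) = (\<Prod>p\<in>?X. 1 - 1 / real p)"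
      using prod.subset_diff[of D ?X "\<lambda>p. 1 - 1 / real p"] D by (simp add: mult.commute)
    finally show "freq Q (?E D) = exp (- mertens_log x) * (\<Prod>p\<in>D. 1 / (real p - 1))"
      by (simp add: prod_primes_eq_exp_mertens_log)
  qed simp
  also have "\<dots> = exp (- mertens_log x) * esymm (\<lambda>p. 1 / (real p - 1)) ?X k"
    by (simp add: esymm_def sum_distrib_left)
  also have "\<dots> \<le> exp (- mertens_log x) * ((\<Sum>p\<in>?X. 1 / (real p - 1)) ^ k / fact k)"
  proof (rule mult_left_mono)
    have "fact k * esymm (\<lambda>p. 1 / (real p - 1)) ?X k \<le> (\<Sum>p\<in>?X. 1 / (real p - 1)) ^ k"
      by (rule esymm_le) (auto dest: prime_upto_ge_2)
    then show "esymm (\<lambda>p. 1 / (real p - 1)) ?X k \<le> (\<Sum>p\<in>?X. 1 / (real p - 1)) ^ k / fact k"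
      by (simp add: field_simps)
  qed simp
  finally show ?thesis by simp
qed

text \<open>Exponential tilting: \<open>S ^ j / fact j\<close> is \<open>exp (y * S) / y ^ j\<close>
  times a Poisson probability of parameter \<open>y * S\<close>. Bounding that probability by
  \<open>M\<close> instead of 1, and summing the geometric series in \<open>1 / y\<close>, keeps a
  factor that can later be made arbitrarily small.\<close>

lemma freq_omega_ge_le:
  assumes Q: "\<Prod>(primes_upto x) dvd Q" "Q > 0" and y: "y > 1"
    and M: "\<And>j. (y * S) ^ j / fact j * exp (- (y * S)) \<le> M"
    and S: "S = (\<Sum>p\<in>primes_upto x. 1 / (real p - 1))"
  shows "freq Q (\<lambda>n. omega_upto x n \<ge> k) \<le> exp (- mertens_log x) * exp (y * S) * M / (1 - 1 / y) / y ^ k"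
proof -
  let ?W = "exp (- mertens_log x)"
  have M0: "M \<ge> 0" using order.trans[OF _ M[of 0]] by simp
  have "freq Q (\<lambda>n. omega_upto x n = j) \<le> ?W * exp (y * S) * M * (1 / y) ^ j" for j
  proof -
    have "S ^ j / fact j = (y * S) ^ j / fact j * exp (- (y * S)) * (exp (y * S) * (1 / y) ^ j)"
      using y by (simp add: power_mult_distrib power_divide exp_minus field_simps)
    also have "\<dots> \<le> M * (exp (y * S) * (1 / y) ^ j)"
      by (rule mult_right_mono[OF M]) (use y in auto)
    finally have "?W * (S ^ j / fact j) \<le> ?W * (M * (exp (y * S) * (1 / y) ^ j))"
      by (rule mult_left_mono) simp
    then show ?thesis using freq_omega_eq_le[OF Q, of j] by (simp add: S mult_ac)
  qed
  note each = this
  let ?c = "card (primes_upto x)"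
  have "freq Q (\<lambda>n. omega_upto x n \<ge> k) \<le> freq Q (\<lambda>n. \<exists>j\<in>{k..?c}. omega_upto x n = j)"
  proof (rule freq_mono)
    fix n assume "omega_upto x n \<ge> k"
    moreover have "omega_upto x n \<le> ?c" unfolding omega_upto_def by (rule card_mono) auto
    ultimately show "\<exists>j\<in>{k..?c}. omega_upto x n = j" by simp
  qed
  also have "\<dots> \<le> (\<Sum>j\<in>{k..?c}. freq Q (\<lambda>n. omega_upto x n = j))" by (rule freq_bex_le) simp
  also have "\<dots> \<le> (\<Sum>j\<in>{k..?c}. ?W * exp (y * S) * M * (1 / y) ^ j)" by (intro sum_mono each)
  also have "\<dots> = ?W * exp (y * S) * M * (\<Sum>j\<in>{k..?c}. (1 / y) ^ j)" by (simp add: sum_distrib_left)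
  also have "\<dots> \<le> ?W * exp (y * S) * M * ((1 / y) ^ k / (1 - 1 / y))"
  proof (rule mult_left_mono)
    have "(\<Sum>j\<in>{k..?c}. (1 / y) ^ j) \<le> (\<Sum>j\<in>{k..<k + Suc ?c}. (1 / y) ^ j)"
      by (rule sum_mono2) (use y in auto)
    also have "\<dots> = (\<Sum>i<Suc ?c. (1 / y) ^ (i + k))"
      by (rule sum.reindex_bij_witness[of _ "\<lambda>i. i + k" "\<lambda>j. j - k"]) auto
    also have "\<dots> = (1 / y) ^ k * (\<Sum>i<Suc ?c. (1 / y) ^ i)"
      by (simp only: power_add sum_distrib_left mult.commute)
    also have "\<dots> \<le> (1 / y) ^ k * (\<Sum>i. (1 / y) ^ i)"
      by (intro mult_left_mono sum_le_suminf summable_geometric) (use y in auto)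
    also have "(\<Sum>i. (1 / y) ^ i) = 1 / (1 - 1 / y)" using y by (intro suminf_geometric) auto
    finally show "(\<Sum>j\<in>{k..?c}. (1 / y) ^ j) \<le> (1 / y) ^ k / (1 - 1 / y)" by simp
  qed (use M0 in simp)
  finally show ?thesis by (simp add: power_divide mult.commute)
qed

text \<open>Up to \<open>l\<close> the probabilities cannot drop fast: over the next
  \<open>J\<close> steps consecutive ratios are at least \<open>l / (l + J)\<close>, so
  \<open>J\<close> successive values are at least half of \<open>p k\<close>. As they sum to at most
  1, \<open>p k <= 2 / J\<close>. Beyond \<open>l\<close> the probabilities no longer
  increase.\<close>

lemma poisson_pmf_small:
  assumes "\<epsilon> > (0::real)"
  obtains \<Lambda> where "\<And>l k. l \<ge> \<Lambda> \<Longrightarrow> l ^ k / fact k * exp (- l) \<le> \<epsilon>"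
proof -
  obtain J :: nat where J: "2 / \<epsilon> \<le> real J" using real_arch_simple by blast
  have "((\<lambda>l. (l / (l + real J)) ^ J) \<longlongrightarrow> 1 ^ J) at_top"
    by (intro tendsto_power) real_asymp
  then have "eventually (\<lambda>l::real. (l / (l + real J)) ^ J > 1 / 2) at_top"
    by (rule order_tendstoD) simp
  then obtain \<Lambda>0 where \<Lambda>0: "\<And>l::real. l \<ge> \<Lambda>0 \<Longrightarrow> (l / (l + real J)) ^ J > 1 / 2"
    by (auto simp: eventually_at_top_linorder)
  show thesis
  proof
    fix l :: real and k :: nat
    assume l: "l \<ge> max 1 \<Lambda>0"
    define p where "p = (\<lambda>k. l ^ k / fact k * exp (- l))"
    have p0: "p k \<ge> 0" for k using l by (simp add: p_def)
    have pS: "p (Suc k) = p k * (l / real (Suc k))" for k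
      by (simp add: p_def field_simps)
    have "(\<lambda>k. l ^ k /\<^sub>R fact k) sums exp l" by (rule exp_converges)
    then have "(\<lambda>k. l ^ k /\<^sub>R fact k * exp (- l)) sums (exp l * exp (- l))" by (rule sums_mult2)
    moreover have "exp l * exp (- l) = 1" by (simp flip: exp_add)
    ultimately have sp: "p sums 1" by (simp add: p_def divide_inverse mult.commute)
    define r where "r = l / (l + real J)"
    have r: "0 \<le> r" "r \<le> 1" using l by (auto simp: r_def)
    have small: "p k \<le> \<epsilon>" if k: "real k \<le> l" for k
    proof -
      have le: "p k * r ^ i \<le> p (k + i)" if "i \<le> J" for i
        using that
      proof (induction i)
        case (Suc i)
        have "r \<le> l / real (Suc (k + i))"
          unfolding r_def by (rule divide_left_mono) (use k Suc l in auto)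
        then have "p k * r ^ i * r \<le> p (k + i) * (l / real (Suc (k + i)))"
          using Suc p0 r by (intro mult_mono) auto
        then show ?case by (simp add: pS mult_ac)
      qed simp
      have "real J * (p k * (1 / 2)) \<le> (\<Sum>i<J. p (k + i))"
      proof -
        have "p k * (1 / 2) \<le> p (k + i)" if "i < J" for i
        proof -
          have "1 / 2 \<le> r ^ J" using \<Lambda>0[of l] l by (simp add: r_def)
          also have "\<dots> \<le> r ^ i" using that r by (intro power_decreasing) auto
          finally have "p k * (1 / 2) \<le> p k * r ^ i" by (rule mult_left_mono[OF _ p0])
          then show ?thesis using le[of i] that by simp
        qed
        then have "(\<Sum>i<J. p k * (1 / 2)) \<le> (\<Sum>i<J. p (k + i))" by (intro sum_mono) simp
        then show ?thesis by simp
      qed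
      also have "\<dots> = (\<Sum>i\<in>{k..<k + J}. p i)"
        by (rule sum.reindex_bij_witness[of _ "\<lambda>i. i - k" "\<lambda>i. k + i"]) auto
      also have "\<dots> \<le> suminf p" by (rule sum_le_suminf) (use sp p0 in \<open>auto simp: sums_iff\<close>)
      also have "\<dots> = 1" using sp by (simp add: sums_iff)
      finally have "real J * p k \<le> 2" by simp
      moreover have "2 / \<epsilon> * p k \<le> real J * p k" by (rule mult_right_mono[OF J p0])
      ultimately have "2 / \<epsilon> * p k \<le> 2" by simp
      then show ?thesis using assms by (simp add: field_simps)
    qed
    have "p k \<le> \<epsilon>"
    proof (induction k)
      case 0
      show ?case by (rule small) (use l in simp)
    next
      case (Suc k)
      show ?case
      proof (cases "real (Suc k) \<le> l")
        case False
        then have "p k * (l / real (Suc k)) \<le> p k * 1"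
          by (intro mult_left_mono p0) (simp add: field_simps)
        then show ?thesis using Suc by (simp add: pS)
      qed (rule small)
    qed
    then show "l ^ k / fact k * exp (- l) \<le> \<epsilon>" by (simp add: p_def)
  qed
qed

section \<open>From prime divisors to divisors up to a bound\<close>

lemma squarefree_eq_prod_prime_factors:
  fixes u :: nat
  assumes "squarefree u"
  shows "u = \<Prod>(prime_factors u)"
proof -
  have u: "u \<noteq> 0" using assms by (auto intro: Nat.gr0I)
  then have "u = (\<Prod>p\<in>prime_factors u. p ^ multiplicity p u)"
    using prod_prime_factors[of u] by simp
  also have "\<dots> = \<Prod>(prime_factors u)"
  proof (rule prod.cong)
    fix p assume "p \<in> prime_factors u"
    then have "multiplicity p u \<le> 1" "multiplicity p u > 0"
      using assms u by (auto simp: squarefree_factorial_semiring'' prime_factors_multiplicity)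
    then have "multiplicity p u = 1" by simp
    then show "p ^ multiplicity p u = p" by simp
  qed simp
  finally show ?thesis .
qed

definition tau_upto :: "nat \<Rightarrow> nat \<Rightarrow> nat" where
  "tau_upto T n = card {d. d dvd n \<and> d \<le> T}"

text \<open>Each divisor is \<open>u * v\<^sup>2\<close> with \<open>u\<close> squarefree;
  \<open>u\<close> is the product of a set of primes dividing \<open>n\<close>, and \<open>v\<close>
  is one of the roots counted by the second factor.\<close>

lemma tau_upto_le:
  assumes "n > 0"
  shows "tau_upto T n \<le> 2 ^ omega_upto (real T) n * card {v \<in> {1..T}. v\<^sup>2 dvd n}"
proof -
  let ?D = "{p \<in> primes_upto (real T). p dvd n}" and ?V = "{v \<in> {1..T}. v\<^sup>2 dvd n}"
  have fin: "finite (Pow ?D \<times> ?V)" by simp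
  have "{d. d dvd n \<and> d \<le> T} \<subseteq> (\<lambda>(A, v). \<Prod>A * v\<^sup>2) ` (Pow ?D \<times> ?V)"
  proof
    fix d assume "d \<in> {d. d dvd n \<and> d \<le> T}"
    then have d: "d dvd n" "d \<le> T" "d > 0" using assms by (auto intro: dvd_pos_nat)
    define u v where "u = squarefree_part d" and "v = square_part d"
    have duv: "d = u * v\<^sup>2" unfolding u_def v_def by (rule squarefree_decompose)
    have sq: "squarefree u" by (simp add: u_def)
    have ud: "u dvd d" "v\<^sup>2 dvd d" using duv by auto
    have v: "v > 0" using d(3) by (auto simp: v_def intro!: Nat.gr0I)
    have "v dvd d" using ud(2) by (metis dvd_trans dvd_power zero_less_numeral pos2)
    then have "v \<le> T" using d by (meson dvd_imp_le order.trans)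
    moreover have "v\<^sup>2 dvd n" using ud d dvd_trans by blast
    ultimately have "v \<in> ?V" using v by simp
    moreover have "prime_factors u \<subseteq> ?D"
    proof
      fix p assume "p \<in> prime_factors u"
      then have "prime p" "p dvd u" by auto
      then show "p \<in> ?D" using ud d dvd_imp_le[of p d]
        by (auto simp: primes_upto_def intro: dvd_trans)
    qed
    moreover have "d = \<Prod>(prime_factors u) * v\<^sup>2"
      using duv squarefree_eq_prod_prime_factors[OF sq] by simp
    ultimately show "d \<in> (\<lambda>(A, v). \<Prod>A * v\<^sup>2) ` (Pow ?D \<times> ?V)" by force
  qed
  then have "tau_upto T n \<le> card ((\<lambda>(A, v). \<Prod>A * v\<^sup>2) ` (Pow ?D \<times> ?V))"
    unfolding tau_upto_def using fin by (intro card_mono) auto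
  also have "\<dots> \<le> card (Pow ?D \<times> ?V)" by (rule card_image_le[OF fin])
  also have "\<dots> = 2 ^ omega_upto (real T) n * card ?V"
    by (simp add: card_cartesian_product card_Pow omega_upto_def)
  finally show ?thesis .
qed

lemma omega_upto_mult_le: "omega_upto x (m * n) \<le> omega_upto x m + omega_upto x n"
proof -
  have "{p \<in> primes_upto x. p dvd m * n} \<subseteq> {p \<in> primes_upto x. p dvd m} \<union> {p \<in> primes_upto x. p dvd n}"
    by (auto simp: primes_upto_def prime_dvd_mult_iff)
  then have "omega_upto x (m * n) \<le> card ({p \<in> primes_upto x. p dvd m} \<union> {p \<in> primes_upto x. p dvd n})"
    unfolding omega_upto_def by (intro card_mono) auto
  also have "\<dots> \<le> omega_upto x m + omega_upto x n" unfolding omega_upto_def by (rule card_Un_le)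
  finally show ?thesis .
qed

lemma omega_upto_square: "omega_upto x (n\<^sup>2) = omega_upto x n"
proof -
  have "{p \<in> primes_upto x. p dvd n\<^sup>2} = {p \<in> primes_upto x. p dvd n}"
    by (auto simp: primes_upto_def prime_dvd_power_iff)
  then show ?thesis by (simp add: omega_upto_def)
qed

lemma two_power_omega_upto_le:
  assumes "v > 0"
  shows "2 ^ omega_upto x v \<le> v"
proof -
  let ?D = "{p \<in> primes_upto x. p dvd v}"
  have "(2::nat) ^ omega_upto x v = (\<Prod>p\<in>?D. 2)" by (simp add: omega_upto_def)
  also have "\<dots> \<le> \<Prod>?D" by (intro prod_mono) (auto simp: primes_upto_def prime_ge_2_nat)
  also have "\<dots> \<le> v"
    by (rule dvd_imp_le, subst prod_primes_dvd_iff) (use assms in \<open>auto simp: primes_upto_def\<close>)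
  finally show ?thesis .
qed

text \<open>\<open>(3 / 2) ^ 4 <= 2 ^ 3\<close> gives \<open>y <= 2 powr (3 / 4)\<close>. The
  exponent \<open>3 / 4\<close> is below 1, so against the weight \<open>1 / v\<^sup>2\<close> the
  sum over \<open>v\<close> still converges, with terms \<open>v powr (- (5 / 4))\<close>.\<close>

lemma power_omega_upto_le:
  assumes "v > 0" "1 < y" "y \<le> 3 / 2"
  shows "y ^ omega_upto x v \<le> real v powr (3 / 4)"
proof -
  have "y ^ 4 \<le> (3 / 2) ^ 4" using assms by (intro power_mono) auto
  also have "\<dots> \<le> (2 powr (3 / 4)) ^ 4" by (simp add: powr_power) (simp add: power_numeral_reduce)
  finally have "y \<le> 2 powr (3 / 4)" by (rule power_le_imp_le_base[of y 3, simplified]) simp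
  then have "y ^ omega_upto x v \<le> (2 powr (3 / 4)) ^ omega_upto x v"
    using assms by (intro power_mono) auto
  also have "\<dots> = (2 ^ omega_upto x v) powr (3 / 4)"
    by (simp add: powr_powr mult.commute flip: powr_realpow)
  also have "\<dots> \<le> real v powr (3 / 4)"
    using two_power_omega_upto_le[OF assms(1), of x] by (intro powr_mono2) (auto simp flip: of_nat_le_iff)
  finally show ?thesis .
qed

text \<open>After division by \<open>v\<^sup>2\<close>, at least \<open>k - omega_upto x v\<close>
  of the primes still divide the cofactor. \<open>G\<close> is assumed for every \<open>R\<close>
  because the cofactor is counted in the period \<open>Q div v\<^sup>2\<close>.\<close>

lemma freq_omega_square_le:
  assumes Q: "v\<^sup>2 * \<Prod>(primes_upto x) dvd Q" "Q > 0" and y: "y > 1" and v: "v > 0" and B: "B \<ge> 0"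
    and G: "\<And>R j. \<Prod>(primes_upto x) dvd R \<Longrightarrow> R > 0 \<Longrightarrow> freq R (\<lambda>n. omega_upto x n \<ge> j) \<le> B / y ^ j"
  shows "freq Q (\<lambda>n. omega_upto x n \<ge> k \<and> v\<^sup>2 dvd n) \<le> B / y ^ k * (y ^ omega_upto x v / real (v\<^sup>2))"
proof -
  let ?w = "omega_upto x v"
  have vQ: "v\<^sup>2 dvd Q" using Q(1) dvd_mult_left by blast
  have "freq Q (\<lambda>n. omega_upto x n \<ge> k \<and> v\<^sup>2 dvd n) \<le> freq Q (\<lambda>n. v\<^sup>2 dvd n \<and> omega_upto x (n div v\<^sup>2) \<ge> k - ?w)"
  proof (rule freq_mono)
    fix n assume n: "omega_upto x n \<ge> k \<and> v\<^sup>2 dvd n"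
    have "omega_upto x (v\<^sup>2 * (n div v\<^sup>2)) \<le> ?w + omega_upto x (n div v\<^sup>2)"
      using omega_upto_mult_le[of x "v\<^sup>2" "n div v\<^sup>2"] by (simp add: omega_upto_square)
    then show "v\<^sup>2 dvd n \<and> omega_upto x (n div v\<^sup>2) \<ge> k - ?w"
      using n by (auto simp: le_diff_conv)
  qed
  also have "\<dots> = freq (Q div v\<^sup>2) (\<lambda>n. omega_upto x n \<ge> k - ?w) / real (v\<^sup>2)"
    using freq_dvd_mult[OF vQ Q(2), of "\<lambda>n. omega_upto x n \<ge> k - ?w"] by simp
  also have "\<dots> \<le> (B / y ^ (k - ?w)) / real (v\<^sup>2)"
  proof (intro divide_right_mono G)
    show "\<Prod>(primes_upto x) dvd Q div v\<^sup>2"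
      using Q(1) vQ v by (simp add: dvd_div_iff_mult mult.commute)
    show "Q div v\<^sup>2 > 0" using vQ Q(2) v by (auto simp: div_greater_zero_iff dvd_imp_le)
  qed simp
  also have "B / y ^ (k - ?w) \<le> B / y ^ k * y ^ ?w"
  proof -
    \<comment> \<open>Natural subtraction truncates at 0, so this is an inequality of exponents and
      not an equality.\<close>
    have "y ^ k \<le> y ^ (?w + (k - ?w))" using y by (intro power_increasing) auto
    then have "B * y ^ k \<le> B * (y ^ ?w * y ^ (k - ?w))"
      by (intro mult_left_mono B) (simp add: power_add)
    then show ?thesis using y by (simp add: field_simps)
  qed
  then have "(B / y ^ (k - ?w)) / real (v\<^sup>2) \<le> (B / y ^ k * y ^ ?w) / real (v\<^sup>2)"
    by (rule divide_right_mono) simp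
  finally show ?thesis by simp
qed

text \<open>Markov's inequality for the number of square divisors, inside the event
  \<open>P\<close>.\<close>

lemma freq_square_divisors_ge_le:
  "freq Q (\<lambda>n. P n \<and> 2 ^ j \<le> card {v \<in> {1..T}. v\<^sup>2 dvd n}) \<le>
     (\<Sum>v=1..T. freq Q (\<lambda>n. P n \<and> v\<^sup>2 dvd n)) / 2 ^ j"
proof -
  have "of_bool (P n \<and> 2 ^ j \<le> card {v \<in> {1..T}. v\<^sup>2 dvd n}) \<le>
      (\<Sum>v=1..T. of_bool (P n \<and> v\<^sup>2 dvd n)) / (2 ^ j :: real)" for n
  proof (cases "P n \<and> 2 ^ j \<le> card {v \<in> {1..T}. v\<^sup>2 dvd n}")
    case True
    have "{v \<in> {1..T}. v\<^sup>2 dvd n} = {1..T} \<inter> {v. v\<^sup>2 dvd n}" by auto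
    then have "(\<Sum>v=1..T. of_bool (P n \<and> v\<^sup>2 dvd n)) = real (card {v \<in> {1..T}. v\<^sup>2 dvd n})"
      using True by simp
    moreover have "real (2 ^ j) \<le> real (card {v \<in> {1..T}. v\<^sup>2 dvd n})" using True by (simp only: of_nat_le_iff)
    ultimately show ?thesis using True by simp
  next
    case False
    then have "of_bool (P n \<and> 2 ^ j \<le> card {v \<in> {1..T}. v\<^sup>2 dvd n}) = (0::real)"
      by (simp only: of_bool_eq)
    then show ?thesis by (simp only:) (intro divide_nonneg_nonneg sum_nonneg; simp)
  qed
  then have "(\<Sum>n=1..Q. of_bool (P n \<and> 2 ^ j \<le> card {v \<in> {1..T}. v\<^sup>2 dvd n})) \<le>
      (\<Sum>n=1..Q. (\<Sum>v=1..T. of_bool (P n \<and> v\<^sup>2 dvd n)) / (2 ^ j :: real))"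
    by (rule sum_mono)
  also have "\<dots> = (\<Sum>v=1..T. \<Sum>n=1..Q. of_bool (P n \<and> v\<^sup>2 dvd n)) / (2 ^ j :: real)"
    by (subst sum.swap) (simp add: sum_divide_distrib)
  finally have "(\<Sum>n=1..Q. of_bool (P n \<and> 2 ^ j \<le> card {v \<in> {1..T}. v\<^sup>2 dvd n})) / real Q \<le>
      (\<Sum>v=1..T. \<Sum>n=1..Q. of_bool (P n \<and> v\<^sup>2 dvd n)) / (2 ^ j :: real) / real Q"
    by (rule divide_right_mono) simp
  then show ?thesis by (simp add: freq_eq_sum sum_divide_distrib mult.commute)
qed

text \<open>If \<open>\<tau> \<ge> 2\<^sup>k\<close> and \<open>\<omega> = k - j < k\<close>, then \<open>n\<close> has at least \<open>2\<^sup>j\<close> square divisors, and Markov's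
  inequality gains \<open>2\<^sup>-\<^sup>j\<close>, more than the factor \<open>y\<^sup>j\<close> lost in lowering \<open>k\<close> to \<open>k - j\<close>.\<close>
lemma freq_tau_ge_le:
  assumes y: "1 < y" "y \<le> 3 / 2" and B: "B \<ge> 0"
    and Q: "(fact T) ^ 3 dvd Q" "Q > 0"
    and G: "\<And>R j. \<Prod>(primes_upto (real T)) dvd R \<Longrightarrow> R > 0 \<Longrightarrow>
              freq R (\<lambda>n. omega_upto (real T) n \<ge> j) \<le> B / y ^ j"
  shows "freq Q (\<lambda>n. 2 ^ k \<le> tau_upto T n) \<le>
    B / y ^ k * (1 + (\<Sum>v. real v powr (- (5 / 4))) / (1 - y / 2))"
proof -
  let ?om = "omega_upto (real T)" and ?s = "\<lambda>n. card {v \<in> {1..T}. v\<^sup>2 dvd n}"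
  let ?Z = "\<Sum>v. real v powr (- (5 / 4))"
  have Z: "summable (\<lambda>v. real v powr (- (5 / 4)))" by (simp add: summable_real_powr_iff)
  have pd: "\<Prod>(primes_upto (real T)) dvd fact T"
    by (subst prod_primes_dvd_iff) (auto simp: primes_upto_def prime_dvd_fact_iff)
  have "freq Q (\<lambda>n. 2 ^ k \<le> tau_upto T n) \<le>
      freq Q (\<lambda>n. ?om n \<ge> k \<or> (\<exists>j\<in>{1..k}. ?om n \<ge> k - j \<and> 2 ^ j \<le> ?s n))"
  proof (rule freq_mono)
    fix n :: nat assume n: "n \<ge> 1" "2 ^ k \<le> tau_upto T n"
    show "?om n \<ge> k \<or> (\<exists>j\<in>{1..k}. ?om n \<ge> k - j \<and> 2 ^ j \<le> ?s n)"
    proof (cases "?om n \<ge> k")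
      case False
      have "(2::nat) ^ ?om n * 2 ^ (k - ?om n) = 2 ^ k" using False by (simp flip: power_add)
      also have "\<dots> \<le> 2 ^ ?om n * ?s n" using n tau_upto_le[of n T] by simp
      finally have "2 ^ (k - ?om n) \<le> ?s n" by simp
      then show ?thesis using False by (intro disjI2 bexI[of _ "k - ?om n"]) auto
    qed simp
  qed
  also have "\<dots> \<le> freq Q (\<lambda>n. ?om n \<ge> k) + freq Q (\<lambda>n. \<exists>j\<in>{1..k}. ?om n \<ge> k - j \<and> 2 ^ j \<le> ?s n)"
    by (rule freq_disj_le)
  also have "\<dots> \<le> B / y ^ k + B / y ^ k * (?Z / (1 - y / 2))"
  proof (rule add_mono)
    have "\<Prod>(primes_upto (real T)) dvd Q"
      using pd Q(1) by (meson dvd_power dvd_trans zero_less_numeral)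
    then show "freq Q (\<lambda>n. ?om n \<ge> k) \<le> B / y ^ k" using Q(2) by (rule G)
    have "freq Q (\<lambda>n. ?om n \<ge> k - j \<and> 2 ^ j \<le> ?s n) \<le> B / y ^ k * ?Z * (y / 2) ^ j" if j: "j \<in> {1..k}" for j
    proof -
      have "(\<Sum>v=1..T. freq Q (\<lambda>n. ?om n \<ge> k - j \<and> v\<^sup>2 dvd n)) \<le> (\<Sum>v=1..T. B / y ^ (k - j) * real v powr (- (5 / 4)))"
      proof (rule sum_mono)
        fix v assume v: "v \<in> {1..T}"
        \<comment> \<open>The origin of the cube: \<open>v\<^sup>2\<close> divides
          \<open>(fact T)\<^sup>2\<close>, and the third \<open>fact T\<close> is a multiple of the
          product of the primes.\<close>
        have "v dvd fact T" using v by (intro dvd_fact) auto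
        then have "v\<^sup>2 * \<Prod>(primes_upto (real T)) dvd (fact T)\<^sup>2 * fact T"
          using pd by (intro mult_dvd_mono dvd_power_same)
        also have "(fact T)\<^sup>2 * fact T = (fact T :: nat) ^ 3" by (simp add: power_numeral_reduce power2_eq_square)
        finally have "v\<^sup>2 * \<Prod>(primes_upto (real T)) dvd Q" using Q(1) dvd_trans by blast
        then have "freq Q (\<lambda>n. ?om n \<ge> k - j \<and> v\<^sup>2 dvd n) \<le> B / y ^ (k - j) * (y ^ ?om v / real (v\<^sup>2))"
          using Q(2) y B v G by (intro freq_omega_square_le) auto
        also have "\<dots> \<le> B / y ^ (k - j) * (real v powr (3 / 4) / real (v\<^sup>2))"
          using y B v by (intro mult_left_mono divide_right_mono power_omega_upto_le) auto
        also have "real v powr (3 / 4) / real (v\<^sup>2) = real v powr (3 / 4 - 2)"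
          using v by (subst powr_diff) simp
        finally show "freq Q (\<lambda>n. ?om n \<ge> k - j \<and> v\<^sup>2 dvd n) \<le> B / y ^ (k - j) * real v powr (- (5 / 4))" by simp
      qed
      also have "\<dots> = B / y ^ (k - j) * (\<Sum>v=1..T. real v powr (- (5 / 4)))" by (simp add: sum_distrib_left)
      also have "\<dots> \<le> B / y ^ (k - j) * ?Z"
        using y B Z by (intro mult_left_mono sum_le_suminf) auto
      finally have "freq Q (\<lambda>n. ?om n \<ge> k - j \<and> 2 ^ j \<le> ?s n) \<le> (B / y ^ (k - j) * ?Z) / 2 ^ j"
        using freq_square_divisors_ge_le[of Q "\<lambda>n. ?om n \<ge> k - j" j T]
        by (meson divide_right_mono order.trans zero_le_numeral zero_le_power)
      also have "y ^ (k - j) = y ^ k / y ^ j" using j y by (simp add: power_diff)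
      then have "(B / y ^ (k - j) * ?Z) / 2 ^ j = B / y ^ k * ?Z * (y / 2) ^ j"
        using y by (simp add: power_divide)
      finally show ?thesis .
    qed
    then have "(\<Sum>j\<in>{1..k}. freq Q (\<lambda>n. ?om n \<ge> k - j \<and> 2 ^ j \<le> ?s n)) \<le> (\<Sum>j\<in>{1..k}. B / y ^ k * ?Z * (y / 2) ^ j)"
      by (rule sum_mono)
    also have "\<dots> = B / y ^ k * ?Z * (\<Sum>j\<in>{1..k}. (y / 2) ^ j)" by (simp add: sum_distrib_left)
    also have "\<dots> \<le> B / y ^ k * ?Z * (\<Sum>j. (y / 2) ^ j)"
      using y B Z by (intro mult_left_mono sum_le_suminf summable_geometric mult_nonneg_nonneg suminf_nonneg) auto
    also have "(\<Sum>j. (y / 2) ^ j) = 1 / (1 - y / 2)" using y by (intro suminf_geometric) auto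
    finally show "freq Q (\<lambda>n. \<exists>j\<in>{1..k}. ?om n \<ge> k - j \<and> 2 ^ j \<le> ?s n) \<le> B / y ^ k * (?Z / (1 - y / 2))"
      using freq_bex_le[of "{1..k}" Q "\<lambda>j n. ?om n \<ge> k - j \<and> 2 ^ j \<le> ?s n"] by simp
  qed
  finally show ?thesis by (simp add: algebra_simps)
qed

text \<open>A representation of some \<open>t <= T\<close> uses only divisors up to
  \<open>T\<close>, so \<open>t\<close> is a subset sum of a set with \<open>tau_upto T n\<close>
  elements.\<close>

lemma card_representable_le:
  assumes "n > 0"
  shows "card {t \<in> {1..T}. sum_of_distinct_divisors t n} \<le> 2 ^ tau_upto T n"
proof -
  let ?D = "{d. d dvd n \<and> d \<le> T}"
  have fD: "finite ?D" by simp
  have "{t \<in> {1..T}. sum_of_distinct_divisors t n} \<subseteq> (\<lambda>S. \<Sum>S) ` Pow ?D"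
  proof
    fix t assume t: "t \<in> {t \<in> {1..T}. sum_of_distinct_divisors t n}"
    then obtain S where S: "S \<subseteq> {d. d dvd n}" "\<Sum>S = t"
      unfolding sum_of_distinct_divisors_def by blast
    have "finite S" by (rule finite_subset[OF S(1)]) (use assms in simp)
    then have "d \<le> T" if "d \<in> S" for d
      using member_le_sum[of d S "\<lambda>x. x"] that S(2) t by auto
    then show "t \<in> (\<lambda>S. \<Sum>S) ` Pow ?D" using S by blast
  qed
  then have "card {t \<in> {1..T}. sum_of_distinct_divisors t n} \<le> card ((\<lambda>S. \<Sum>S) ` Pow ?D)"
    using fD by (intro card_mono) auto
  also have "\<dots> \<le> card (Pow ?D)" using fD by (intro card_image_le) auto
  also have "\<dots> = 2 ^ tau_upto T n" using fD by (simp add: card_Pow tau_upto_def)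
  finally show ?thesis .
qed

text \<open>Double counting of pairs \<open>(t, n)\<close> over a period: an \<open>n\<close> with
  fewer than \<open>K\<close> divisors up to \<open>T\<close> represents at most
  \<open>2 ^ K\<close> values, any other at most \<open>T\<close>.\<close>

lemma sum_divisor_sum_density_le:
  assumes "fact T dvd Q" "Q > 0"
  shows "(\<Sum>t=1..T. divisor_sum_density t) \<le> 2 ^ K + real T * freq Q (\<lambda>n. K \<le> tau_upto T n)"
proof -
  have "(\<Sum>t=1..T. divisor_sum_density t) = (\<Sum>t=1..T. freq Q (sum_of_distinct_divisors t))"
  proof (rule sum.cong)
    fix t assume "t \<in> {1..T}"
    then have "fact t dvd (fact T :: nat)" by (intro fact_dvd) auto
    then have "fact t dvd Q" using assms(1) dvd_trans by blast
    then show "divisor_sum_density t = freq Q (sum_of_distinct_divisors t)"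
      using assms(2) by (rule divisor_sum_density_eq_freq)
  qed simp
  also have "\<dots> = (\<Sum>n=1..Q. \<Sum>t=1..T. of_bool (sum_of_distinct_divisors t n)) / real Q"
    by (simp only: freq_eq_sum flip: sum_divide_distrib) (subst sum.swap, rule refl)
  also have "\<dots> \<le> (\<Sum>n=1..Q. 2 ^ K + real T * of_bool (K \<le> tau_upto T n)) / real Q"
  proof (intro divide_right_mono sum_mono)
    fix n assume n: "n \<in> {1..Q}"
    have "{t \<in> {1..T}. sum_of_distinct_divisors t n} = {1..T} \<inter> {t. sum_of_distinct_divisors t n}" by auto
    then have eq: "(\<Sum>t=1..T. of_bool (sum_of_distinct_divisors t n)) = real (card {t \<in> {1..T}. sum_of_distinct_divisors t n})"
      by simp
    have le: "card {t \<in> {1..T}. sum_of_distinct_divisors t n} \<le> card {1..T}"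
      by (rule card_mono) auto
    show "(\<Sum>t=1..T. of_bool (sum_of_distinct_divisors t n)) \<le> 2 ^ K + real T * of_bool (K \<le> tau_upto T n)"
    proof (cases "K \<le> tau_upto T n")
      case True
      then show ?thesis using le unfolding eq by (simp add: add_increasing)
    next
      case False
      have "card {t \<in> {1..T}. sum_of_distinct_divisors t n} \<le> 2 ^ tau_upto T n"
        by (rule card_representable_le) (use n in simp)
      also have "\<dots> \<le> 2 ^ K" using False by (intro power_increasing) auto
      finally have "real (card {t \<in> {1..T}. sum_of_distinct_divisors t n}) \<le> real (2 ^ K)"
        by (rule of_nat_mono)
      then show ?thesis using False unfolding eq by simp
    qed
  qed simp
  also have "\<dots> = 2 ^ K + real T * freq Q (\<lambda>n. K \<le> tau_upto T n)"
    using assms(2) by (simp only: sum.distrib freq_eq_sum add_divide_distrib flip: sum_distrib_left) simp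
  finally show ?thesis .
qed

section \<open>The exponent and the constant\<close>

text \<open>\<open>ln x <= x - 1\<close> at \<open>x = ln 2\<close>. The sign makes
  \<open>v powr (- erdos_delta)\<close> nonincreasing.\<close>

lemma erdos_delta_nonneg: "erdos_delta \<ge> 0"
proof -
  have l: "0 < ln (2::real)" by simp
  have "ln (ln 2) \<le> ln 2 - (1::real)" by (rule ln_le_minus_one) simp
  then have "(1 + ln (ln 2)) / ln 2 \<le> (1::real)" using l by (simp add: divide_le_eq)
  then show ?thesis by (simp add: erdos_delta_def)
qed

text \<open>Lets the Poisson parameter be replaced by minus the logarithm of Mertens' product at a
  bounded cost.\<close>

lemma sum_inverse_pred_primes_bounds:
  "mertens_log x \<le> (\<Sum>p\<in>primes_upto x. 1 / (real p - 1))"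
  "(\<Sum>p\<in>primes_upto x. 1 / (real p - 1)) \<le> mertens_log x + (\<Sum>k. 1 / (real k * (real k - 1)))"
proof -
  have p: "prime p" "real p \<ge> 2" if "p \<in> primes_upto x" for p
    using that prime_upto_ge_2 by (auto simp: primes_upto_def)
  show "mertens_log x \<le> (\<Sum>p\<in>primes_upto x. 1 / (real p - 1))"
    unfolding mertens_log_def by (intro sum_mono ln_euler_factor_bounds p)
  have "(\<Sum>p\<in>primes_upto x. 1 / (real p - 1)) \<le>
      (\<Sum>p\<in>primes_upto x. - ln (1 - 1 / real p) + 1 / (real p * (real p - 1)))"
  proof (rule sum_mono)
    fix p assume "p \<in> primes_upto x"
    note p = p[OF this]
    have "1 / (real p - 1) = 1 / real p + 1 / (real p * (real p - 1))"
      using p by (simp add: divide_simps)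
    then show "1 / (real p - 1) \<le> - ln (1 - 1 / real p) + 1 / (real p * (real p - 1))"
      using ln_euler_factor_bounds(1)[OF p(1)] by simp
  qed
  also have "\<dots> \<le> mertens_log x + (\<Sum>k. 1 / (real k * (real k - 1)))"
    unfolding sum.distrib mertens_log_def[symmetric]
    by (intro add_left_mono sum_primes_inverse_pronic_le finite_primes_upto)
  finally show "(\<Sum>p\<in>primes_upto x. 1 / (real p - 1)) \<le> mertens_log x + (\<Sum>k. 1 / (real k * (real k - 1)))" .
qed

text \<open>Here \<open>2 ^ Suc k\<close> plays the role of \<open>log T\<close>. Requiring
  \<open>2 ^ k\<close> divisors, half of it, makes the term \<open>2 ^ (2 ^ k)\<close> negligible
  against \<open>T\<close>. The arbitrary \<open>\<epsilon>\<close> comes from the vanishing Poisson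
  mass and is what excludes the boundary case \<open>c4 = erdos_delta\<close>.\<close>

lemma sum_divisor_sum_density_small:
  fixes \<epsilon> :: real
  assumes \<epsilon>: "\<epsilon> > 0"
  shows "eventually (\<lambda>k. (\<Sum>t=1..nat \<lfloor>exp (2 ^ Suc k :: real)\<rfloor>. divisor_sum_density t) \<le>
           \<epsilon> * real (nat \<lfloor>exp (2 ^ Suc k :: real)\<rfloor>) * (2 ^ Suc k) powr (- erdos_delta)) at_top"
proof -
  define y where "y = 1 / ln (2::real)"
  define T where "T = (\<lambda>k. nat \<lfloor>exp (2 ^ Suc k :: real)\<rfloor>)"
  define N where "N = (\<lambda>k. real (2 ^ Suc k))"
  define S where "S = (\<lambda>k. \<Sum>p\<in>primes_upto (real (T k)). 1 / (real p - 1))"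
  define A where "A = (\<lambda>k. mertens_log (real (T k)))"
  define C' where "C' = (\<Sum>k. 1 / (real k * (real k - 1)))"
  \<comment> \<open>From \<open>2 / 3 <= ln 2 < 1\<close>. The lower bound serves the geometric
    series in \<open>1 / y\<close>, the upper one that in \<open>y / 2\<close> and
    \<open>power_omega_upto_le\<close>.\<close>
  have y: "1 < y" "y \<le> 3 / 2"
    using ln2_ge_two_thirds ln_2_less_1 by (auto simp: y_def divide_simps)
  obtain L where "(\<lambda>N. mertens_log (exp (real N)) - ln (real N)) \<longlonglongrightarrow> L"
    by (rule mertens_log_minus_ln_convergent)
  then have "Bseq (\<lambda>N. mertens_log (exp (real N)) - ln (real N))"
    by (rule convergentI[THEN convergent_imp_Bseq])
  then obtain C where C: "\<And>N. \<bar>mertens_log (exp (real N)) - ln (real N)\<bar> \<le> C"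
    by (auto simp: Bseq_def)
  have T_eq: "real p \<le> real (T k) \<longleftrightarrow> real p \<le> exp (N k)" for p k
  proof -
    have "real p \<le> real (T k) \<longleftrightarrow> int p \<le> \<lfloor>exp (N k)\<rfloor>"
      unfolding of_nat_le_iff T_def N_def by (simp add: le_nat_iff)
    then show ?thesis by (simp add: le_floor_iff)
  qed
  have A_eq: "A k = mertens_log (exp (N k))" for k
  proof -
    have "primes_upto (real (T k)) = primes_upto (exp (N k))" unfolding primes_upto_def T_eq by simp
    then show ?thesis by (simp add: A_def mertens_log_def)
  qed
  have A: "ln (N k) - C \<le> A k" "A k \<le> ln (N k) + C" for k
    using C[of "2 ^ Suc k"] unfolding A_eq N_def by linarith+
  have S: "A k \<le> S k" "S k \<le> A k + C'" for k
    unfolding A_def S_def C'_def by (rule sum_inverse_pred_primes_bounds)+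
  have lnN: "ln (N k) = (real k + 1) * ln 2" for k
    unfolding N_def by (simp add: ln_realpow del: power_Suc)
  \<comment> \<open>\<open>E\<close> absorbs the bounded errors: \<open>C\<close> between
    \<open>mertens_log\<close> and \<open>ln (N k)\<close>, \<open>C'\<close> between
    \<open>S\<close> and \<open>mertens_log\<close>.\<close>
  define E where "E = exp (C + y * (C + C'))"
  define Z where "Z = (\<Sum>v. real v powr (- (5 / 4)))"
  define F where "F = E * y * (1 + Z / (1 - y / 2)) / (1 - 1 / y)"
  have Z0: "Z \<ge> 0" unfolding Z_def by (intro suminf_nonneg) (auto simp: summable_real_powr_iff)
  then have D0: "1 + Z / (1 - y / 2) > 0" using y by (intro add_pos_nonneg divide_nonneg_nonneg) auto
  then have F: "F > 0" unfolding F_def E_def using y by (intro divide_pos_pos mult_pos_pos) auto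
  \<comment> \<open>\<open>F\<close> collects the constant factors, so this choice leaves exactly
    \<open>\<epsilon> / 2\<close>; the other half pays for \<open>2 ^ (2 ^ k)\<close>.\<close>
  define M where "M = \<epsilon> / 2 / F"
  have M: "M > 0" using F \<epsilon> by (simp add: M_def)
  obtain \<Lambda> where \<Lambda>: "\<And>l j. l \<ge> \<Lambda> \<Longrightarrow> l ^ j / fact j * exp (- l) \<le> M"
    using poisson_pmf_small[OF M] by blast
  have "filterlim (\<lambda>k. (real k + 1) * ln 2 - C) at_top sequentially" by real_asymp
  then have "eventually (\<lambda>k. (real k + 1) * ln 2 - C \<ge> \<bar>\<Lambda>\<bar>) sequentially"
    by (simp add: filterlim_at_top)
  moreover have "eventually (\<lambda>k. 2 powr (N k / 2) \<le> \<epsilon> / 2 * ((exp (N k) - 1) * N k powr (- erdos_delta))) sequentially"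
  proof -
    have "((\<lambda>v::real. 2 powr (v / 2) / ((exp v - 1) * v powr (- erdos_delta))) \<longlongrightarrow> 0) at_top"
      by real_asymp
    then have "eventually (\<lambda>v::real. 2 powr (v / 2) / ((exp v - 1) * v powr (- erdos_delta)) < \<epsilon> / 2) at_top"
      by (rule order_tendstoD) (use \<epsilon> in simp)
    then have "eventually (\<lambda>v::real. 2 powr (v / 2) \<le> \<epsilon> / 2 * ((exp v - 1) * v powr (- erdos_delta))) at_top"
      using eventually_gt_at_top[of 0]
    proof eventually_elim
      case (elim v)
      have "(exp v - 1) * v powr (- erdos_delta) > 0" using elim by simp
      then show ?case using elim by (simp only: pos_divide_less_eq less_imp_le)
    qed
    moreover have "filterlim N at_top sequentially" unfolding N_def by real_asymp
    ultimately show ?thesis by (rule eventually_compose_filterlim)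
  qed
  ultimately show ?thesis
  proof eventually_elim
    case (elim k)
    define W where "W = exp (- A k) * exp (y * S k)"
    define B where "B = W * M / (1 - 1 / y)"
    define Q :: nat where "Q = (fact (T k)) ^ 3"
    have Q: "fact (T k) dvd Q" "Q > 0" "(fact (T k)) ^ 3 dvd Q" by (auto simp: Q_def)
    have B0: "B \<ge> 0" using y M by (simp add: B_def W_def)
    have "1 * \<bar>\<Lambda>\<bar> \<le> y * S k"
      using elim(1) A(1)[of k] S(1)[of k] y lnN[of k] by (intro mult_mono) auto
    then have pois: "(y * S k) ^ j / fact j * exp (- (y * S k)) \<le> M" for j
      by (intro \<Lambda>) linarith
    have "freq Q (\<lambda>n. 2 ^ k \<le> tau_upto (T k) n) \<le> B / y ^ k * (1 + Z / (1 - y / 2))"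
      unfolding Z_def
    proof (rule freq_tau_ge_le[OF y B0 Q(3,2)])
      fix R j :: nat assume R: "\<Prod>(primes_upto (real (T k))) dvd R" "R > 0"
      show "freq R (\<lambda>n. j \<le> omega_upto (real (T k)) n) \<le> B / y ^ j"
        using freq_omega_ge_le[OF R y(1) pois, of j] by (simp add: B_def W_def A_def S_def)
    qed
    also have "B / y ^ k * (1 + Z / (1 - y / 2)) = W / y ^ k * (M * ((1 + Z / (1 - y / 2)) / (1 - 1 / y)))"
      by (simp add: B_def mult_ac)
    also have "\<dots> \<le> (E * y * N k powr (- erdos_delta)) * (M * ((1 + Z / (1 - y / 2)) / (1 - 1 / y)))"
    proof (rule mult_right_mono)
      have yk: "y ^ k = exp (real k * ln y)" using y by (simp add: exp_of_nat_mult)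
      have "W / y ^ k = exp (- A k + y * S k - real k * ln y)"
        unfolding W_def yk exp_diff exp_add by (rule refl)
      also have "\<dots> \<le> exp (- (ln (N k) - C) + y * (ln (N k) + C + C') - real k * ln y)"
        using A[of k] S[of k] y by (intro exp_mono add_mono diff_mono mult_left_mono) auto
      \<comment> \<open>As \<open>ln (N k) = (k + 1) * ln 2\<close>, the tilt gives
        \<open>y * ln (N k) = k + 1\<close>. The power \<open>y ^ k\<close> falls one factor short
        of \<open>k + 1\<close>, which leaves the extra \<open>ln y\<close>.\<close>
      also have "- (ln (N k) - C) + y * (ln (N k) + C + C') - real k * ln y =
          (C + y * (C + C')) + ln y + (- erdos_delta * ln (N k))"
      proof -
        have "ln y = - ln (ln 2)" by (simp add: y_def ln_div)
        moreover have "y * ln 2 = 1" by (simp add: y_def)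
        moreover have "erdos_delta * ln 2 = ln 2 - (1 + ln (ln 2))"
          by (simp add: erdos_delta_def left_diff_distrib)
        ultimately have "erdos_delta * ln 2 = ln 2 - 1 + ln y" by simp
        then have "erdos_delta * ln (N k) = (real k + 1) * (ln 2 - 1 + ln y)"
          unfolding lnN by (metis mult.left_commute)
        moreover have "y * ln (N k) = real k + 1" unfolding lnN using \<open>y * ln 2 = 1\<close>
          by (metis mult.left_commute mult.right_neutral)
        ultimately show ?thesis using lnN[of k] by (simp add: algebra_simps)
      qed
      also have "exp \<dots> = E * y * N k powr (- erdos_delta)"
      proof -
        have "exp (ln y) = y" using y by simp
        moreover have "N k powr (- erdos_delta) = exp (- erdos_delta * ln (N k))"
          by (simp add: powr_def N_def)
        ultimately show ?thesis unfolding E_def exp_add by simp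
      qed
      finally show "W / y ^ k \<le> E * y * N k powr (- erdos_delta)" .
      show "0 \<le> M * ((1 + Z / (1 - y / 2)) / (1 - 1 / y))" using M D0 y by simp
    qed
    also have "\<dots> = \<epsilon> / 2 * N k powr (- erdos_delta)"
    proof -
      have "(E * y * N k powr (- erdos_delta)) * (M * ((1 + Z / (1 - y / 2)) / (1 - 1 / y))) =
          M * F * N k powr (- erdos_delta)"
        by (simp add: F_def)
      also have "M * F = \<epsilon> / 2" using F by (simp add: M_def)
      finally show ?thesis .
    qed
    finally have fr: "freq Q (\<lambda>n. 2 ^ k \<le> tau_upto (T k) n) \<le> \<epsilon> / 2 * N k powr (- erdos_delta)" .
    have "(\<Sum>t=1..T k. divisor_sum_density t) \<le> 2 ^ (2 ^ k) + real (T k) * freq Q (\<lambda>n. 2 ^ k \<le> tau_upto (T k) n)"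
      by (rule sum_divisor_sum_density_le[OF Q(1,2)])
    also have "\<dots> \<le> \<epsilon> / 2 * (real (T k) * N k powr (- erdos_delta)) + real (T k) * (\<epsilon> / 2 * N k powr (- erdos_delta))"
    proof (rule add_mono)
      have "(2::real) ^ (2 ^ k) = 2 powr (N k / 2)" by (simp add: N_def flip: powr_realpow)
      also have "\<dots> \<le> \<epsilon> / 2 * ((exp (N k) - 1) * N k powr (- erdos_delta))" by (rule elim(2))
      also have "\<dots> \<le> \<epsilon> / 2 * (real (T k) * N k powr (- erdos_delta))"
      proof (intro mult_left_mono mult_right_mono)
        show "exp (N k) - 1 \<le> real (T k)" unfolding T_def N_def of_nat_power of_nat_numeral by linarith
      qed (use \<epsilon> in auto)
      finally show "(2::real) ^ (2 ^ k) \<le> \<epsilon> / 2 * (real (T k) * N k powr (- erdos_delta))" .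
    qed (intro mult_left_mono fr, simp)
    also have "\<dots> = \<epsilon> * real (T k) * N k powr (- erdos_delta)" by simp
    finally show ?case by (simp add: T_def N_def)
  qed
qed

theorem corollary4:
  fixes c c3 c4 :: real
  assumes c: "is_practical_constant c"
    and c3: "c3 > 0"
    and d: "(\<lambda>t::nat. divisor_sum_density t) \<sim>[at_top] (\<lambda>t. c3 / ln (real t) powr c4)"
  shows "erdos_delta < c4 \<and> c4 \<le> 1 \<and> (c4 = 1 \<longrightarrow> c3 \<ge> c * exp (- euler_mascheroni))"
proof -
  have "((\<lambda>t. divisor_sum_density t / (c3 / ln (real t) powr c4)) \<longlongrightarrow> 1) at_top"
  proof (rule asymp_equivD_strong[OF d])
    show "\<forall>\<^sub>F t in at_top. divisor_sum_density t \<noteq> 0 \<or> c3 / ln (real t) powr c4 \<noteq> 0"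
      using eventually_ge_at_top[of 2] by eventually_elim (use c3 in auto)
  qed
  then have lim: "((\<lambda>t. divisor_sum_density t * ln (real t) powr c4 / c3) \<longlongrightarrow> 1) at_top" by simp

  have "erdos_delta < c4"
  proof (rule ccontr)
    assume "\<not> erdos_delta < c4"
    then have le: "c4 \<le> erdos_delta" by simp
    have "eventually (\<lambda>t. 1 / 2 < divisor_sum_density t * ln (real t) powr c4 / c3) at_top"
      using lim by (rule order_tendstoD) simp
    then obtain t0 where t0: "\<And>t. t \<ge> t0 \<Longrightarrow> 1 / 2 < divisor_sum_density t * ln (real t) powr c4 / c3"
      by (auto simp: eventually_at_top_linorder)
    define T where "T = (\<lambda>k. nat \<lfloor>exp (2 ^ Suc k :: real)\<rfloor>)"
    \<comment> \<open>Since \<open>3 > e\<close>, \<open>ln t >= 1\<close>, so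
      \<open>c4 <= erdos_delta\<close> permits passing to the power \<open>- erdos_delta\<close>;
      then \<open>ln t\<close> is replaced by its bound \<open>2 ^ Suc k\<close>, which is
      independent of \<open>t\<close>.\<close>
    have low: "c3 / 2 * (2 ^ Suc k) powr (- erdos_delta) \<le> divisor_sum_density t"
      if t: "t \<ge> t0" "t \<ge> 3" "t \<le> T k" for t k
    proof -
      have "exp 1 \<le> real t" using t(2) exp_le by linarith
      then have l1: "ln (real t) \<ge> 1" using t(2) by (subst ln_ge_iff) auto
      have "real t \<le> exp (2 ^ Suc k)" using t(3) by (simp add: T_def le_nat_iff le_floor_iff)
      then have "ln (real t) \<le> ln (exp (2 ^ Suc k))" using t(2) by (subst ln_le_cancel_iff) auto
      then have l2: "ln (real t) \<le> 2 ^ Suc k" by simp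
      have "(2 ^ Suc k) powr (- erdos_delta) \<le> ln (real t) powr (- erdos_delta)"
        using l1 l2 erdos_delta_nonneg by (intro powr_mono2') auto
      also have "\<dots> \<le> ln (real t) powr (- c4)" using l1 le by (intro powr_mono) auto
      finally have "c3 / 2 * (2 ^ Suc k) powr (- erdos_delta) \<le> c3 / 2 * ln (real t) powr (- c4)"
        using c3 by (intro mult_left_mono) auto
      also have "\<dots> \<le> divisor_sum_density t"
        using t0[OF t(1)] c3 l1 by (simp add: powr_minus field_simps)
      finally show ?thesis .
    qed
    have dpos: "divisor_sum_density t \<ge> 0" for t
      by (subst divisor_sum_density_eq_freq[of t "fact t"]) (auto simp: freq_nonneg)
    define m where "m = max t0 3"
    have "filterlim T at_top at_top" unfolding T_def by real_asymp
    \<comment> \<open>More than half of all \<open>t <= T k\<close> then obey the lower bound, while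
      \<open>\<epsilon> = c3 / 8\<close> allows the whole sum only a quarter of \<open>T k\<close>
      times that bound.\<close>
    then have "eventually (\<lambda>k. T k \<ge> 2 * m + 1) at_top" by (simp add: filterlim_at_top)
    moreover have "eventually (\<lambda>k. (\<Sum>t=1..T k. divisor_sum_density t) \<le>
        c3 / 8 * real (T k) * (2 ^ Suc k) powr (- erdos_delta)) at_top"
      unfolding T_def by (rule sum_divisor_sum_density_small) (use c3 in simp)
    ultimately have "eventually (\<lambda>k::nat. False) at_top"
    proof eventually_elim
      case (elim k)
      let ?q = "(2 ^ Suc k) powr (- erdos_delta) :: real"
      have q: "?q > 0" by simp
      have "real (T k - m) * (c3 / 2 * ?q) = (\<Sum>t\<in>{m<..T k}. c3 / 2 * ?q)" by simp
      also have "\<dots> \<le> (\<Sum>t\<in>{m<..T k}. divisor_sum_density t)"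
        by (intro sum_mono low) (auto simp: m_def)
      also have "\<dots> \<le> (\<Sum>t=1..T k. divisor_sum_density t)"
        by (rule sum_mono2) (use dpos in auto)
      also have "\<dots> \<le> c3 / 8 * real (T k) * ?q" by (rule elim(2))
      finally have "real (T k - m) * (c3 / 2 * ?q) \<le> real (T k) / 4 * (c3 / 2 * ?q)"
        by (simp add: mult_ac)
      moreover have "c3 / 2 * ?q > 0" using q c3 by simp
      ultimately have "real (T k - m) \<le> real (T k) / 4" by (simp only: mult_le_cancel_right_pos)
      then show False using elim(1) by (simp add: of_nat_diff)
    qed
    then show False by simp
  qed

  \<comment> \<open>Stated for an arbitrary limit \<open>a\<close> to serve two cases:
    \<open>a = 0\<close> if \<open>c4 > 1\<close>, and \<open>a = c3\<close> if
    \<open>c4 = 1\<close>.\<close>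
  moreover have prod_lim: "((\<lambda>t. divisor_sum_density t * ln (real t)) \<longlongrightarrow> a) at_top"
    if a: "((\<lambda>t. c3 * ln (real t) powr (1 - c4)) \<longlongrightarrow> a) at_top" for a
  proof -
    have "((\<lambda>t. divisor_sum_density t * ln (real t) powr c4 / c3 * (c3 * ln (real t) powr (1 - c4))) \<longlongrightarrow> 1 * a) at_top"
      by (intro tendsto_intros lim a)
    moreover have "eventually (\<lambda>t. divisor_sum_density t * ln (real t) powr c4 / c3 * (c3 * ln (real t) powr (1 - c4)) =
        divisor_sum_density t * ln (real t)) at_top"
      using eventually_ge_at_top[of 2]
      by eventually_elim (use c3 in \<open>simp add: powr_diff\<close>)
    ultimately show ?thesis by (simp add: tendsto_cong)
  qed
  have lower: "c * exp (- euler_mascheroni) \<le> a"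
    if a: "((\<lambda>t. c3 * ln (real t) powr (1 - c4)) \<longlongrightarrow> a) at_top" for a
  proof (rule dense_le)
    fix \<mu> assume "\<mu> < c * exp (- euler_mascheroni)"
    then have "eventually (\<lambda>t. \<mu> \<le> divisor_sum_density t * ln (real t)) at_top"
      by (rule divisor_sum_density_lower[OF c])
    with prod_lim[OF a] show "\<mu> \<le> a"
      by (rule tendsto_lowerbound) simp
  qed
  have "c4 \<le> 1"
  proof (rule ccontr)
    assume "\<not> c4 \<le> 1"
    then have "1 - c4 < 0" by simp
    then have "((\<lambda>t::nat. c3 * ln (real t) powr (1 - c4)) \<longlongrightarrow> 0) at_top"
      by real_asymp
    then have "c * exp (- euler_mascheroni) \<le> 0" by (rule lower)
    then show False using practical_constant_limit(1)[OF c] by (simp add: mult_le_0_iff)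
  qed
  moreover have "c3 \<ge> c * exp (- euler_mascheroni)" if "c4 = 1"
  proof (rule lower)
    have "eventually (\<lambda>t. c3 = c3 * ln (real t) powr (1 - c4)) at_top"
      using eventually_ge_at_top[of 2] by eventually_elim (simp add: that)
    then show "((\<lambda>t. c3 * ln (real t) powr (1 - c4)) \<longlongrightarrow> c3) at_top"
      by (rule Lim_transform_eventually[OF tendsto_const])
  qed
  ultimately show ?thesis by blast
qed

end
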